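(* Let $\{u_j\},\{\tilde u_j\},\{y_j\}\subset V_h$ and $\{\alpha_j\}\subset\mathbb{R}$ be generated by the Anderson accelerated Newton iteration with depth $m=1$ (defined in the context). For every step $k\ge 2$ such that $\alpha_k\neq 0$ and $u_j\in B(0,R)$ for all $j\le k$, where $R<\nu M^{-1}$, the residuals satisfy $$\|\nabla y_{k+1}\|\le C_2\,\|\nabla y_k\|^{3/2},$$ where $C_2$ is a constant depending on $\nu, M, R, \|f\|_{-1}, \alpha_k,\theta_k$, with $\theta_k=\|\nabla((1-\alpha_k)y_k+\alpha_k y_{k-1})\|/\|\nabla y_k\|$.
   Context: Setting. $\Omega\subset\mathbb{R}^d$ ($d=2,3$) is a simply connected domain that is a convex polytope or has smooth boundary; $(\cdot,\cdot)$ and $\|\cdot\|$ are the $L^2(\Omega)$ inner product and norm; $X=H_0^1(\Omega)^d$, $Q=L^2_0(\Omega)$; $\nu>0$; $f$ is a given forcing with dual norm $\|f\|_{-1}=\sup_{0\ne v\in X}(f,v)/\|\nabla v\|$. $X_h\subset X$, $Q_h\subset Q$ are finite-dimensional finite element spaces satisfying the discrete inf-sup condition, and $V_h=\{v\in X_h: (\nabla\cdot v,q)=0\ \forall q\in Q_h\}$. The trilinear form is $b(u,v,w)=\frac12\big((u\cdot\nabla v,w)-(u\cdot\nabla w,v)\big)$; it satisfies $b(u,v,v)=0$ and $b(u,v,w)\le M\|\nabla u\|\|\nabla v\|\|\nabla w\|$ for all $u,v,w\in X$, with a constant $M>0$ depending only on $|\Omega|$. The small data condition $\nu^{-2}M\|f\|_{-1}<1$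 is assumed throughout. For $R<\nu M^{-1}$ let $B(0,R)=\{v\in V_h:\|\nabla v\|\le R\}$. For $u\in B(0,R)$, $G(u)\in V_h$ denotes the unique solution of $$b(u,G(u),v)+b(G(u),u,v)-b(u,u,v)+\nu(\nabla G(u),\nabla v)=(f,v)\quad\forall v\in V_h$$ (the Newton solution operator for the stationary Navier-Stokes equations). Anderson accelerated Newton iteration with depth $m=1$. Step 0: choose $u_0\in B(0,R)$. Step 1: $\tilde u_1=G(u_0)$, $y_1=\tilde u_1-u_0$, $u_1=\tilde u_1$. Step $k$, $k=2,3,\dots$: (a) $\tilde u_k=G(u_{k-1})$, $y_k=\tilde u_k-u_{k-1}$; (b) find $\alpha_k\in\mathbb{R}$ minimizing $\|\nabla((1-\alpha_k)y_k+\alpha_k y_{k-1})\|$; (c) $u_k=(1-\alpha_k)\tilde u_k+\alpha_k\tilde u_{k-1}$. *)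

theory Defs
  imports "HOL-Analysis.Analysis"
begin

section \<open>Lebesgue and Sobolev spaces\<close>

text \<open>
  Elements of \<open>L\<^sup>2(\<Omega>)\<close> and of its subspaces are represented by functions on the whole space, whose
  values outside \<open>\<Omega>\<close> are irrelevant. Equality in \<open>L\<^sup>2(\<Omega>)\<close> is equality almost everywhere on \<open>\<Omega>\<close>.
\<close>

definition ae_eq :: "'a::euclidean_space set \<Rightarrow> ('a \<Rightarrow> 'b) \<Rightarrow> ('a \<Rightarrow> 'b) \<Rightarrow> bool" where
  "ae_eq \<Omega> u v \<longleftrightarrow> (AE x in lebesgue_on \<Omega>. u x = v x)"

definition L2_space :: "'a::euclidean_space set \<Rightarrow> ('a \<Rightarrow> 'b::euclidean_space) set" where
  "L2_space \<Omega> = {u. u \<in> borel_measurable (lebesgue_on \<Omega>) \<and>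
                     integrable (lebesgue_on \<Omega>) (\<lambda>x. (norm (u x))\<^sup>2)}"

text \<open>For matrix-valued functions the pointwise inner product is the Frobenius product.\<close>

definition l2_inner ::
  "'a::euclidean_space set \<Rightarrow> ('a \<Rightarrow> 'b::euclidean_space) \<Rightarrow> ('a \<Rightarrow> 'b) \<Rightarrow> real" where
  "l2_inner \<Omega> u v = (LINT x|lebesgue_on \<Omega>. u x \<bullet> v x)"

definition l2_norm :: "'a::euclidean_space set \<Rightarrow> ('a \<Rightarrow> 'b::euclidean_space) \<Rightarrow> real" where
  "l2_norm \<Omega> u = sqrt (l2_inner \<Omega> u u)"

text \<open>The pressure space \<open>L\<^sup>2\<^sub>0(\<Omega>)\<close>; integrability is automatic if \<open>\<Omega>\<close> has finite measure.\<close>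

definition L2_mean_zero :: "'a::euclidean_space set \<Rightarrow> ('a \<Rightarrow> real) set" where
  "L2_mean_zero \<Omega> = {q \<in> L2_space \<Omega>. integrable (lebesgue_on \<Omega>) q \<and> (LINT x|lebesgue_on \<Omega>. q x) = 0}"

primrec C_k :: "nat \<Rightarrow> ('a::euclidean_space \<Rightarrow> 'b::real_normed_vector) \<Rightarrow> bool" where
  "C_k 0 f \<longleftrightarrow> continuous_on UNIV f"
| "C_k (Suc k) f \<longleftrightarrow> (\<forall>x. f differentiable at x) \<and>
     (\<forall>e\<in>Basis. C_k k (\<lambda>x. frechet_derivative f (at x) e))"

definition smooth :: "('a::euclidean_space \<Rightarrow> 'b::real_normed_vector) \<Rightarrow> bool" where
  "smooth f \<longleftrightarrow> (\<forall>k. C_k k f)"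

definition test_fun :: "'a::euclidean_space set \<Rightarrow> ('a \<Rightarrow> 'b::real_normed_vector) \<Rightarrow> bool" where
  "test_fun \<Omega> \<phi> \<longleftrightarrow> smooth \<phi> \<and> compact (closure {x. \<phi> x \<noteq> 0}) \<and> closure {x. \<phi> x \<noteq> 0} \<subseteq> \<Omega>"

text \<open>\<open>g x $ i $ j\<close> is the weak partial derivative of the \<open>i\<close>-th component in direction \<open>j\<close>.\<close>

definition is_weak_grad ::
  "(real^'d) set \<Rightarrow> (real^'d \<Rightarrow> real^'d) \<Rightarrow> (real^'d \<Rightarrow> real^'d^'d) \<Rightarrow> bool" where
  "is_weak_grad \<Omega> u g \<longleftrightarrow>
     (\<forall>\<phi>::real^'d \<Rightarrow> real. test_fun \<Omega> \<phi> \<longrightarrow>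
        (\<forall>i j. (LINT x|lebesgue_on \<Omega>. u x $ i * frechet_derivative \<phi> (at x) (axis j 1))
             = - (LINT x|lebesgue_on \<Omega>. g x $ i $ j * \<phi> x)))"

definition H1_space :: "(real^'d) set \<Rightarrow> (real^'d \<Rightarrow> real^'d) set" where
  "H1_space \<Omega> = {u \<in> L2_space \<Omega>. \<exists>g\<in>L2_space \<Omega>. is_weak_grad \<Omega> u g}"

text \<open>
  The weak gradient of \<open>u\<close> in \<open>H\<^sup>1(\<Omega>)\<^sup>d\<close>, which is unique up to equality almost everywhere on \<open>\<Omega>\<close>;
  unspecified outside \<open>H\<^sup>1(\<Omega>)\<^sup>d\<close>.
\<close>

definition grad :: "(real^'d) set \<Rightarrow> (real^'d \<Rightarrow> real^'d) \<Rightarrow> (real^'d \<Rightarrow> real^'d^'d)" where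
  "grad \<Omega> u = (SOME g. g \<in> L2_space \<Omega> \<and> is_weak_grad \<Omega> u g)"

definition divergence :: "(real^'d) set \<Rightarrow> (real^'d \<Rightarrow> real^'d) \<Rightarrow> (real^'d \<Rightarrow> real)" where
  "divergence \<Omega> u = (\<lambda>x. \<Sum>i\<in>UNIV. grad \<Omega> u x $ i $ i)"

definition h1_norm :: "(real^'d) set \<Rightarrow> (real^'d \<Rightarrow> real^'d) \<Rightarrow> real" where
  "h1_norm \<Omega> u = sqrt ((l2_norm \<Omega> u)\<^sup>2 + (l2_norm \<Omega> (grad \<Omega> u))\<^sup>2)"

text \<open>\<open>H\<^sup>1\<^sub>0(\<Omega>)\<^sup>d\<close>: the closure of the test functions in the \<open>H\<^sup>1\<close> norm.\<close>

definition H10_space :: "(real^'d) set \<Rightarrow> (real^'d \<Rightarrow> real^'d) set" where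
  "H10_space \<Omega> = {u \<in> H1_space \<Omega>.
     \<exists>\<phi>. (\<forall>n::nat. test_fun \<Omega> (\<phi> n)) \<and> (\<lambda>n. h1_norm \<Omega> (\<lambda>x. \<phi> n x - u x)) \<longlonglongrightarrow> 0}"


section \<open>The Navier-Stokes setting\<close>

text \<open>
  \<open>C\<^sup>\<infinity>\<close> boundary: near each boundary point, \<open>\<Omega>\<close> is the sublevel set of a smooth function that is
  regular at that point.
\<close>

definition smooth_boundary :: "'a::euclidean_space set \<Rightarrow> bool" where
  "smooth_boundary \<Omega> \<longleftrightarrow>
     (\<forall>x\<in>frontier \<Omega>. \<exists>U \<rho>. open U \<and> x \<in> U \<and> smooth (\<rho>::'a \<Rightarrow> real) \<and>
        frechet_derivative \<rho> (at x) \<noteq> (\<lambda>_. 0) \<and> \<Omega> \<inter> U = {y\<in>U. \<rho> y < 0})"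

definition flow_domain :: "'a::euclidean_space set \<Rightarrow> bool" where
  "flow_domain \<Omega> \<longleftrightarrow> open \<Omega> \<and> \<Omega> \<noteq> {} \<and> connected \<Omega> \<and> simply_connected \<Omega> \<and>
     ((\<exists>P. polytope P \<and> \<Omega> = interior P) \<or> smooth_boundary \<Omega>)"

text \<open>
  \<open>S\<close> consists of all representatives, within the space \<open>X\<close>, of the linear combinations of finitely
  many elements of \<open>X\<close>.
\<close>

definition finite_dim_subspace ::
  "'a::euclidean_space set \<Rightarrow> ('a \<Rightarrow> 'b::real_vector) set \<Rightarrow> ('a \<Rightarrow> 'b) set \<Rightarrow> bool" where
  "finite_dim_subspace \<Omega> X S \<longleftrightarrow>
     (\<exists>B. finite B \<and> B \<subseteq> X \<and> S = {u\<in>X. \<exists>c. ae_eq \<Omega> u (\<lambda>x. \<Sum>e\<in>B. c e *\<^sub>R e x)})"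

text \<open>The infimum and supremum are taken in \<open>ereal\<close>, so that no side condition is needed.\<close>

definition inf_sup_condition ::
  "(real^'d) set \<Rightarrow> (real^'d \<Rightarrow> real^'d) set \<Rightarrow> (real^'d \<Rightarrow> real) set \<Rightarrow> bool" where
  "inf_sup_condition \<Omega> Xh Qh \<longleftrightarrow>
     (\<exists>\<beta>>0. ereal \<beta> \<le>
        (INF q\<in>{q\<in>Qh. \<not> ae_eq \<Omega> q (\<lambda>_. 0)}.
           SUP v\<in>{v\<in>Xh. \<not> ae_eq \<Omega> v (\<lambda>_. 0)}.
             ereal (l2_inner \<Omega> (divergence \<Omega> v) q / (l2_norm \<Omega> (grad \<Omega> v) * l2_norm \<Omega> q))))"

definition discretely_div_free ::
  "(real^'d) set \<Rightarrow> (real^'d \<Rightarrow> real^'d) set \<Rightarrow> (real^'d \<Rightarrow> real) set \<Rightarrow> (real^'d \<Rightarrow> real^'d) set" where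
  "discretely_div_free \<Omega> Xh Qh = {v\<in>Xh. \<forall>q\<in>Qh. l2_inner \<Omega> (divergence \<Omega> v) q = 0}"

text \<open>The convective derivative \<open>u \<cdot> \<nabla>v\<close>, with \<open>i\<close>-th component \<open>\<Sum>\<^sub>j u\<^sub>j \<partial>\<^sub>j v\<^sub>i\<close>.\<close>

definition convect ::
  "(real^'d) set \<Rightarrow> (real^'d \<Rightarrow> real^'d) \<Rightarrow> (real^'d \<Rightarrow> real^'d) \<Rightarrow> (real^'d \<Rightarrow> real^'d)" where
  "convect \<Omega> u v = (\<lambda>x. grad \<Omega> v x *v u x)"

definition bform ::
  "(real^'d) set \<Rightarrow> (real^'d \<Rightarrow> real^'d) \<Rightarrow> (real^'d \<Rightarrow> real^'d) \<Rightarrow> (real^'d \<Rightarrow> real^'d) \<Rightarrow> real" where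
  "bform \<Omega> u v w = 1/2 * (l2_inner \<Omega> (convect \<Omega> u v) w - l2_inner \<Omega> (convect \<Omega> u w) v)"

text \<open>
  \<open>M\<close> is a continuity constant of the trilinear form on \<open>H\<^sup>1\<^sub>0(\<Omega>)\<^sup>d\<close>. The integrability clause says
  that the integrals defining the form exist; without it the inequality would be about the default
  value 0 of a divergent Bochner integral. It always holds in dimensions 2 and 3, by the embedding
  of \<open>H\<^sup>1\<^sub>0\<close> into \<open>L\<^sup>4\<close>.
\<close>

definition bform_bound :: "(real^'d) set \<Rightarrow> real \<Rightarrow> bool" where
  "bform_bound \<Omega> M \<longleftrightarrow> M > 0 \<and>
     (\<forall>u\<in>H10_space \<Omega>. \<forall>v\<in>H10_space \<Omega>. \<forall>w\<in>H10_space \<Omega>.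
        integrable (lebesgue_on \<Omega>) (\<lambda>x. convect \<Omega> u v x \<bullet> w x) \<and>
        bform \<Omega> u v w \<le> M * l2_norm \<Omega> (grad \<Omega> u) * l2_norm \<Omega> (grad \<Omega> v) * l2_norm \<Omega> (grad \<Omega> w))"

text \<open>
  The forcing is an element of \<open>H\<^sup>-\<^sup>1(\<Omega>)\<^sup>d\<close>, the dual of \<open>H\<^sup>1\<^sub>0(\<Omega>)\<^sup>d\<close>; \<open>f v\<close> stands for \<open>(f, v)\<close>.
  A square-integrable force \<open>F\<close> is the functional \<open>l2_inner \<Omega> F\<close>.
\<close>

definition forcing :: "(real^'d) set \<Rightarrow> ((real^'d \<Rightarrow> real^'d) \<Rightarrow> real) \<Rightarrow> bool" where
  "forcing \<Omega> f \<longleftrightarrow>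
     (\<forall>v\<in>H10_space \<Omega>. \<forall>w\<in>H10_space \<Omega>. f (\<lambda>x. v x + w x) = f v + f w) \<and>
     (\<forall>v\<in>H10_space \<Omega>. \<forall>c. f (\<lambda>x. c *\<^sub>R v x) = c * f v) \<and>
     (\<exists>K. \<forall>v\<in>H10_space \<Omega>. \<bar>f v\<bar> \<le> K * l2_norm \<Omega> (grad \<Omega> v))"

definition dual_norm :: "(real^'d) set \<Rightarrow> ((real^'d \<Rightarrow> real^'d) \<Rightarrow> real) \<Rightarrow> real" where
  "dual_norm \<Omega> f =
     (SUP v\<in>{v\<in>H10_space \<Omega>. \<not> ae_eq \<Omega> v (\<lambda>_. 0)}. f v / l2_norm \<Omega> (grad \<Omega> v))"

definition nse_setting ::
  "(real^'d) set \<Rightarrow> (real^'d \<Rightarrow> real^'d) set \<Rightarrow> (real^'d \<Rightarrow> real) set \<Rightarrow> real \<Rightarrow> real \<Rightarrow>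
   ((real^'d \<Rightarrow> real^'d) \<Rightarrow> real) \<Rightarrow> bool" where
  "nse_setting \<Omega> Xh Qh \<nu> M f \<longleftrightarrow>
     flow_domain \<Omega> \<and>
     finite_dim_subspace \<Omega> (H10_space \<Omega>) Xh \<and>
     finite_dim_subspace \<Omega> (L2_mean_zero \<Omega>) Qh \<and>
     inf_sup_condition \<Omega> Xh Qh \<and>
     \<nu> > 0 \<and> bform_bound \<Omega> M \<and> forcing \<Omega> f \<and>
     dual_norm \<Omega> f * M / \<nu>\<^sup>2 < 1"


section \<open>Anderson accelerated Newton iteration\<close>

definition grad_ball ::
  "(real^'d) set \<Rightarrow> (real^'d \<Rightarrow> real^'d) set \<Rightarrow> real \<Rightarrow> (real^'d \<Rightarrow> real^'d) set" where
  "grad_ball \<Omega> Vh R = {v\<in>Vh. l2_norm \<Omega> (grad \<Omega> v) \<le> R}"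

text \<open>
  \<open>g = G(u)\<close>. As \<open>G(u)\<close> is unique only up to equality almost everywhere, the solution operator is
  given by its graph.
\<close>

definition is_newton_step ::
  "(real^'d) set \<Rightarrow> (real^'d \<Rightarrow> real^'d) set \<Rightarrow> real \<Rightarrow> ((real^'d \<Rightarrow> real^'d) \<Rightarrow> real) \<Rightarrow>
   (real^'d \<Rightarrow> real^'d) \<Rightarrow> (real^'d \<Rightarrow> real^'d) \<Rightarrow> bool" where
  "is_newton_step \<Omega> Vh \<nu> f u g \<longleftrightarrow> g \<in> Vh \<and>
     (\<forall>v\<in>Vh. bform \<Omega> u g v + bform \<Omega> g u v - bform \<Omega> u u v
              + \<nu> * l2_inner \<Omega> (grad \<Omega> g) (grad \<Omega> v) = f v)"

text \<open>
  The first \<open>N\<close> steps of the iteration of depth 1. The number of steps is finite because \<open>G\<close> need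
  not be defined at iterates outside the ball.
\<close>

definition anderson_newton ::
  "(real^'d) set \<Rightarrow> (real^'d \<Rightarrow> real^'d) set \<Rightarrow> real \<Rightarrow> ((real^'d \<Rightarrow> real^'d) \<Rightarrow> real) \<Rightarrow> real \<Rightarrow> nat \<Rightarrow>
   (nat \<Rightarrow> real^'d \<Rightarrow> real^'d) \<Rightarrow> (nat \<Rightarrow> real^'d \<Rightarrow> real^'d) \<Rightarrow> (nat \<Rightarrow> real^'d \<Rightarrow> real^'d) \<Rightarrow>
   (nat \<Rightarrow> real) \<Rightarrow> bool" where
  "anderson_newton \<Omega> Vh \<nu> f R N u ut y \<alpha> \<longleftrightarrow>
     u 0 \<in> grad_ball \<Omega> Vh R \<and>
     (\<forall>k\<in>{1..N}. u k \<in> Vh \<and> ut k \<in> Vh \<and> y k \<in> Vh) \<and>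
     (\<forall>k\<in>{1..N}. is_newton_step \<Omega> Vh \<nu> f (u (k - 1)) (ut k) \<and>
                 ae_eq \<Omega> (y k) (\<lambda>x. ut k x - u (k - 1) x)) \<and>
     (N \<ge> 1 \<longrightarrow> ae_eq \<Omega> (u 1) (ut 1)) \<and>
     (\<forall>k\<in>{2..N}.
        is_arg_min (\<lambda>a. l2_norm \<Omega> (grad \<Omega> (\<lambda>x. (1 - a) *\<^sub>R y k x + a *\<^sub>R y (k - 1) x)))
          (\<lambda>_. True) (\<alpha> k) \<and>
        ae_eq \<Omega> (u k) (\<lambda>x. (1 - \<alpha> k) *\<^sub>R ut k x + \<alpha> k *\<^sub>R ut (k - 1) x))"

text \<open>The gain \<open>\<theta>\<^sub>k\<close> of the optimization step; it is 0 by convention if the residual \<open>y\<^sub>k\<close> vanishes.\<close>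

definition opt_gain ::
  "(real^'d) set \<Rightarrow> (nat \<Rightarrow> real^'d \<Rightarrow> real^'d) \<Rightarrow> (nat \<Rightarrow> real) \<Rightarrow> nat \<Rightarrow> real" where
  "opt_gain \<Omega> y \<alpha> k =
     l2_norm \<Omega> (grad \<Omega> (\<lambda>x. (1 - \<alpha> k) *\<^sub>R y k x + \<alpha> k *\<^sub>R y (k - 1) x)) / l2_norm \<Omega> (grad \<Omega> (y k))"

end

theory Submission
  imports Defs
begin

text \<open>
  Write \<open>b\<close> for the trilinear form, and let \<open>\<rho>(g)(v) = (f, v) - b(g, g, v) - \<nu> (\<nabla>g, \<nabla>v)\<close>. A Newton step
  from \<open>u\<close> to \<open>g = u + y\<close> has \<open>\<rho>(g)(v) = - b(y, y, v)\<close>. As \<open>\<rho>\<close> is quadratic, for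
  \<open>u\<^sub>k = (1 - \<alpha>) g + \<alpha> g'\<close> with \<open>g\<close>, \<open>g'\<close> the last two Newton updates, with residuals \<open>y\<close>, \<open>y'\<close>, and
  \<open>w = g - g'\<close>,
  \<open>\<rho>(u\<^sub>k) = - (1 - \<alpha>) b(y, y, \<cdot>) - \<alpha> b(y', y', \<cdot>) + \<alpha> (1 - \<alpha>) b(w, w, \<cdot>)\<close>, and coercivity of the
  linearization at \<open>u\<^sub>k\<close> in the ball bounds the next residual by \<open>\<rho>(u\<^sub>k)\<close>. Comparing the equations of
  \<open>g\<close> and \<open>g'\<close>, tested with \<open>w\<close>, gives \<open>w = O(y\<^sup>2 + y'\<^sup>2)\<close>, because \<open>b(w, g, w) = b(w, u\<^sub>k, w)\<close>. The
  minimizing property of \<open>\<alpha> \<noteq> 0\<close> gives \<open>y' = O(y)\<close>. So the next residual is even of second order in \<open>y\<close>;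
  the exponent \<open>3/2\<close> follows since \<open>y\<close> is bounded on the ball.

  The gradient being chosen by \<open>SOME\<close>, its linearity rests on the fundamental lemma of the calculus of
  variations; closure of \<open>H\<^sup>1\<^sub>0\<close> under linear combinations needs test functions to lie in \<open>H\<^sup>1\<close>, that is,
  integration by parts, which is obtained from translation invariance of the Lebesgue integral.
\<close>

section \<open>Smooth functions\<close>

text \<open>Serves the product rule in \<open>C_k_mult\<close>: each term of the derivative keeps
  one factor undifferentiated, and that factor has to be weakened by one order.\<close>

lemma C_k_Suc_imp: "C_k (Suc k) f \<Longrightarrow> C_k k f"
proof (induction k arbitrary: f)
  case 0
  then show ?case
    by (auto intro!: continuous_at_imp_continuous_on differentiable_imp_continuous_within)
next
  case (Suc k)
  show ?case
    using Suc.prems Suc.IH by (simp only: C_k.simps(2)[of "Suc k" f] C_k.simps(2)[of k f]) blast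
qed

lemma C_k_zero: "C_k k (\<lambda>x. 0)"
  by (induction k) auto

lemma C_k_const: "C_k k (\<lambda>x. c)"
  by (cases k) (auto simp: C_k_zero)

lemma frechet_derivative_eqI: "(f has_derivative f') (at x) \<Longrightarrow> frechet_derivative f (at x) = f'"
  using frechet_derivative_at by metis

lemma C_k_add:
  assumes "C_k k f" "C_k k g"
  shows "C_k k (\<lambda>x. f x + g x)"
  using assms
proof (induction k arbitrary: f g)
  case 0
  then show ?case by (auto intro: continuous_intros)
next
  case (Suc k)
  then have d: "\<And>x. f differentiable at x" "\<And>x. g differentiable at x" by auto
  have "frechet_derivative (\<lambda>x. f x + g x) (at x) =
      (\<lambda>e. frechet_derivative f (at x) e + frechet_derivative g (at x) e)" for x
    using d by (intro frechet_derivative_eqI derivative_intros) (auto simp: frechet_derivative_works)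
  with Suc d show ?case by auto
qed

lemma C_k_linear:
  assumes L: "bounded_linear L" and "C_k k f"
  shows "C_k k (\<lambda>x. L (f x))"
  using assms(2)
proof (induction k arbitrary: f)
  case 0
  then show ?case
    by (auto intro: bounded_linear.continuous_on[OF L])
next
  case (Suc k)
  then have d: "\<And>x. f differentiable at x" by auto
  have h: "((\<lambda>x. L (f x)) has_derivative (\<lambda>e. L (frechet_derivative f (at x) e))) (at x)" for x
    using d by (intro bounded_linear.has_derivative[OF L]) (auto simp: frechet_derivative_works)
  have "frechet_derivative (\<lambda>x. L (f x)) (at x) = (\<lambda>e. L (frechet_derivative f (at x) e))" for x
    using h by (rule frechet_derivative_eqI)
  with Suc h show ?case by (auto simp: differentiable_def)
qed

lemma C_k_mult:
  fixes f g :: "'a::euclidean_space \<Rightarrow> real"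
  assumes "C_k k f" "C_k k g"
  shows "C_k k (\<lambda>x. f x * g x)"
  using assms
proof (induction k arbitrary: f g)
  case 0
  then show ?case by (auto intro: continuous_intros)
next
  case (Suc k)
  then have d: "\<And>x. f differentiable at x" "\<And>x. g differentiable at x" by auto
  have h: "((\<lambda>x. f x * g x) has_derivative
      (\<lambda>e. f x * frechet_derivative g (at x) e + frechet_derivative f (at x) e * g x)) (at x)" for x
    using d by (intro has_derivative_mult) (auto simp: frechet_derivative_works)
  then have "frechet_derivative (\<lambda>x. f x * g x) (at x) =
      (\<lambda>e. f x * frechet_derivative g (at x) e + frechet_derivative f (at x) e * g x)" for x
    by (rule frechet_derivative_eqI)
  with Suc h C_k_Suc_imp[OF Suc.prems(1)] C_k_Suc_imp[OF Suc.prems(2)] show ?case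
    by (auto simp: differentiable_def intro!: C_k_add)
qed

lemma C_k_prod:
  fixes f :: "'i \<Rightarrow> 'a::euclidean_space \<Rightarrow> real"
  assumes "\<And>i. i \<in> I \<Longrightarrow> C_k k (f i)"
  shows "C_k k (\<lambda>x. \<Prod>i\<in>I. f i x)"
  using assms by (induction I rule: infinite_finite_induct) (auto intro!: C_k_mult simp: C_k_const)

text \<open>
  The family is closed under differentiation up to linear combinations, so one induction, over all \<open>m\<close>
  simultaneously, shows smoothness.
\<close>

definition flat :: "nat \<Rightarrow> real \<Rightarrow> real" where
  "flat m t = (if t \<le> 0 then 0 else exp (- (1 / t)) / t ^ m)"

text \<open>With s = 1 / t the expression becomes s ^ m / exp s, and the exponential dominates every
  power at infinity.\<close>

lemma flat_tendsto_0: "((\<lambda>t. exp (- (1 / t)) / t ^ m) \<longlongrightarrow> 0) (at_right (0::real))"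
proof -
  have "((\<lambda>t::real. inverse t ^ m / exp (inverse t)) \<longlongrightarrow> 0) (at_right 0)"
    by (rule filterlim_compose[OF tendsto_power_div_exp_0 filterlim_inverse_at_top_right])
  then show ?thesis
    by (rule filterlim_cong[THEN iffD1, rotated 3])
      (auto simp: eventually_at_filter exp_minus field_simps)
qed

lemma DERIV_flat: "(flat m has_real_derivative flat (m + 2) t - real m * flat (m + 1) t) (at t)"
proof (cases t "0::real" rule: linorder_cases)
  case less
  have "((\<lambda>_. 0) has_real_derivative 0) (at t)" by simp
  then have "(flat m has_real_derivative 0) (at t)"
    by (rule has_field_derivative_transform_within_open[of _ _ _ "{..<0}"]) (use less in \<open>auto simp: flat_def\<close>)
  with less show ?thesis by (simp add: flat_def)
next
  case equal
  \<comment> \<open>At 0 the difference quotient is treated from each side: on the right it is the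
    expression of \<open>flat_tendsto_0\<close> with exponent \<open>Suc m\<close>, on the left it
    is identically 0.\<close>
  have "((\<lambda>h. (flat m h - flat m 0) / (h - 0)) \<longlongrightarrow> 0) (at_right 0)"
    using flat_tendsto_0[of "Suc m"]
    by (rule filterlim_cong[THEN iffD1, rotated 3])
      (auto simp: eventually_at_filter flat_def field_simps)
  moreover have "((\<lambda>h. (flat m h - flat m 0) / (h - 0)) \<longlongrightarrow> 0) (at_left 0)"
    by (rule filterlim_cong[THEN iffD1, rotated 3, OF tendsto_const])
      (auto simp: eventually_at_filter flat_def)
  ultimately have "((\<lambda>h. (flat m h - flat m 0) / (h - 0)) \<longlongrightarrow> 0) (at 0)"
    by (simp add: filterlim_split_at)
  then have "(flat m has_real_derivative 0) (at 0)"
    by (simp add: has_field_derivative_iff)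
  with equal show ?thesis by (simp add: flat_def)
next
  case greater
  have "((\<lambda>t. exp (- (1 / t)) / t ^ m) has_real_derivative
      exp (- (1 / t)) / t ^ (m + 2) - real m * (exp (- (1 / t)) / t ^ (m + 1))) (at t)"
  \<comment> \<open>Splitting on m keeps the truncated exponent m - 1 out of the derivative of
    \<open>t ^ m\<close>.\<close>
  proof (cases m)
    case 0
    then show ?thesis
      using greater by (auto intro!: derivative_eq_intros simp: field_simps power2_eq_square)
  next
    case (Suc n)
    have "((\<lambda>t. t ^ m) has_real_derivative real m * t ^ n) (at t)"
      using DERIV_pow[of m t UNIV] Suc by simp
    moreover have "((\<lambda>t. exp (- (1 / t))) has_real_derivative exp (- (1 / t)) / t\<^sup>2) (at t)"
      using greater by (auto intro!: derivative_eq_intros simp: field_simps power2_eq_square)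
    ultimately have "((\<lambda>t. exp (- (1 / t)) / t ^ m) has_real_derivative
        (exp (- (1 / t)) / t\<^sup>2 * t ^ m - exp (- (1 / t)) * (real m * t ^ n)) / (t ^ m * t ^ m)) (at t)"
      using greater by (intro DERIV_divide) auto
    moreover have "(exp (- (1 / t)) / t\<^sup>2 * t ^ m - exp (- (1 / t)) * (real m * t ^ n)) / (t ^ m * t ^ m) =
        exp (- (1 / t)) / t ^ (m + 2) - real m * (exp (- (1 / t)) / t ^ (m + 1))"
      using greater by (simp add: Suc field_simps power2_eq_square)
    ultimately show ?thesis by simp
  qed
  then have "(flat m has_real_derivative
      exp (- (1 / t)) / t ^ (m + 2) - real m * (exp (- (1 / t)) / t ^ (m + 1))) (at t)"
    by (rule has_field_derivative_transform_within_open[of _ _ _ "{0<..}"]) (use greater in \<open>auto simp: flat_def\<close>)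
  with greater show ?thesis by (simp add: flat_def)
qed

lemma C_k_flat_affine: "C_k k (\<lambda>x::'a::euclidean_space. flat m (x \<bullet> a + b))"
proof (induction k arbitrary: m)
  case 0
  have "continuous_on UNIV (flat m)"
    by (meson DERIV_flat DERIV_isCont continuous_at_imp_continuous_on)
  then show ?case
    by (auto intro!: continuous_on_compose2[of UNIV "flat m"] continuous_intros)
next
  case (Suc k)
  have h: "((\<lambda>x::'a. flat m (x \<bullet> a + b)) has_derivative
      (\<lambda>e. (e \<bullet> a) * (flat (m + 2) (x \<bullet> a + b) - real m * flat (m + 1) (x \<bullet> a + b)))) (at x)" for x
  proof -
    have "((\<lambda>x::'a. x \<bullet> a + b) has_derivative (\<lambda>e. e \<bullet> a)) (at x)"
      by (auto intro!: derivative_eq_intros)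
    from DERIV_compose_FDERIV[OF DERIV_flat this] show ?thesis by simp
  qed
  have eq: "frechet_derivative (\<lambda>x::'a. flat m (x \<bullet> a + b)) (at x) = 
      (\<lambda>e. (e \<bullet> a) * (flat (m + 2) (x \<bullet> a + b) - real m * flat (m + 1) (x \<bullet> a + b)))" for x
    using h by (rule frechet_derivative_eqI)
  have "C_k k (\<lambda>x. (e \<bullet> a) * (flat (m + 2) (x \<bullet> a + b) + (- real m) * flat (m + 1) (x \<bullet> a + b)))" for e
    by (intro C_k_mult C_k_add C_k_const Suc)
  then have "C_k k (\<lambda>x. (e \<bullet> a) * (flat (m + 2) (x \<bullet> a + b) - real m * flat (m + 1) (x \<bullet> a + b)))" for e
    by simp
  with h eq show ?case by (auto simp: differentiable_def)
qed

text \<open>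
  The parameter \<open>n\<close> steepens the bump: since \<open>flat 0 (n * t)\<close> tends to 1 for \<open>t > 0\<close>, the bumps tend
  to the indicator of the open box without any cutoff construction.
\<close>

definition bump :: "'a::euclidean_space \<Rightarrow> 'a \<Rightarrow> real \<Rightarrow> 'a \<Rightarrow> real" where
  "bump a b n x = (\<Prod>e\<in>Basis. flat 0 (n * ((x - a) \<bullet> e)) * flat 0 (n * ((b - x) \<bullet> e)))"

lemma flat_bounds: "0 \<le> flat 0 t" "flat 0 t \<le> 1"
  by (auto simp: flat_def)

lemma bump_bounds: "0 \<le> bump a b n x" "bump a b n x \<le> 1"
  by (auto simp: bump_def flat_bounds intro!: prod_nonneg prod_le_1 mult_le_one)

lemma bump_eq_0: "0 \<le> n \<Longrightarrow> x \<notin> box a b \<Longrightarrow> bump a b n x = 0"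
  by (fastforce simp: bump_def mem_box flat_def inner_diff_left not_less mult_le_0_iff)

lemma test_fun_bump:
  assumes "cbox a b \<subseteq> \<Omega>" "0 \<le> n"
  shows "test_fun \<Omega> (bump a b n)"
proof -
  have "C_k k (bump a b n)" for k
  proof -
    have "bump a b n = (\<lambda>x. \<Prod>e\<in>Basis. flat 0 (x \<bullet> (n *\<^sub>R e) + - (n * (a \<bullet> e))) *
                                      flat 0 (x \<bullet> ((- n) *\<^sub>R e) + n * (b \<bullet> e)))"
      by (auto simp: bump_def fun_eq_iff algebra_simps)
    then show ?thesis
      by (simp only:) (intro C_k_prod C_k_mult C_k_flat_affine)
  qed
  moreover have "closure {x. bump a b n x \<noteq> 0} \<subseteq> cbox a b"
  proof (rule closure_minimal)
    show "{x. bump a b n x \<noteq> 0} \<subseteq> cbox a b"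
      using bump_eq_0[OF assms(2)] box_subset_cbox by blast
  qed (rule closed_cbox)
  ultimately show ?thesis
    using assms unfolding test_fun_def smooth_def
    by (meson bounded_cbox bounded_subset closed_closure compact_eq_bounded_closed order_trans)
qed

lemma bump_tendsto_indicator: "(\<lambda>n. bump a b (real n) x) \<longlonglongrightarrow> indicator (box a b) x"
proof (cases "x \<in> box a b")
  case False
  then show ?thesis by (simp add: bump_eq_0)
next
  case True
  have "(\<lambda>n. flat 0 (real n * t)) \<longlonglongrightarrow> 1" if "t > 0" for t
  proof -
    have "(\<lambda>n. exp (- (1 / (real n * t)))) \<longlonglongrightarrow> exp (- 0)"
    proof (intro tendsto_intros)
      have "(\<lambda>n. (1 / t) / real n) \<longlonglongrightarrow> 0" by (rule lim_const_over_n)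
      then show "(\<lambda>n. 1 / (real n * t)) \<longlonglongrightarrow> 0" by (simp add: mult.commute)
    qed
    moreover have "\<forall>\<^sub>F n in sequentially. exp (- (1 / (real n * t))) = flat 0 (real n * t)"
      using eventually_gt_at_top[of 0]
      by eventually_elim (use that in \<open>auto simp: flat_def mult_le_0_iff\<close>)
    ultimately show ?thesis
      by (auto dest: Lim_transform_eventually)
  qed
  then have "(\<lambda>n. bump a b (real n) x) \<longlonglongrightarrow> (\<Prod>e\<in>(Basis::'a set). 1 * 1)"
    unfolding bump_def using True by (intro tendsto_prod tendsto_mult) (auto simp: mem_box inner_diff_left)
  with True show ?thesis by simp
qed

section \<open>Square-integrable functions\<close>

lemma L2_spaceD:
  assumes "u \<in> L2_space \<Omega>"
  shows "u \<in> borel_measurable (lebesgue_on \<Omega>)" "integrable (lebesgue_on \<Omega>) (\<lambda>x. (norm (u x))\<^sup>2)"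
  using assms by (auto simp: L2_space_def)

text \<open>The product of the norms is dominated pointwise by the sum of their squares, which is
  integrable.\<close>

lemma L2_bilinear_integrable:
  fixes u :: "'a::euclidean_space \<Rightarrow> 'b::euclidean_space" and v :: "'a \<Rightarrow> 'c::euclidean_space"
  assumes "u \<in> L2_space \<Omega>" "v \<in> L2_space \<Omega>"
    and "h \<in> borel_measurable (lebesgue_on \<Omega>)" "\<And>x. \<bar>h x\<bar> \<le> norm (u x) * norm (v x)"
  shows "integrable (lebesgue_on \<Omega>) h"
proof (rule Bochner_Integration.integrable_bound)
  show "integrable (lebesgue_on \<Omega>) (\<lambda>x. (norm (u x))\<^sup>2 + (norm (v x))\<^sup>2)"
    using assms by (auto dest: L2_spaceD)
  have "\<bar>h x\<bar> \<le> (norm (u x))\<^sup>2 + (norm (v x))\<^sup>2" for x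
    using assms(4)[of x] sum_squares_bound[of "norm (u x)" "norm (v x)"]
      mult_nonneg_nonneg[of "norm (u x)" "norm (v x)"] by simp
  then show "AE x in lebesgue_on \<Omega>. norm (h x) \<le> norm ((norm (u x))\<^sup>2 + (norm (v x))\<^sup>2)"
    by auto
qed fact

lemma L2_inner_integrable:
  assumes "u \<in> L2_space \<Omega>" "v \<in> L2_space \<Omega>"
  shows "integrable (lebesgue_on \<Omega>) (\<lambda>x. u x \<bullet> v x)"
  using assms
  by (intro L2_bilinear_integrable[OF assms])
    (auto dest: L2_spaceD intro!: borel_measurable_inner simp: Cauchy_Schwarz_ineq2)

lemma L2_mult_integrable:
  fixes u :: "'a::euclidean_space \<Rightarrow> real"
  assumes "u \<in> L2_space \<Omega>" "v \<in> L2_space \<Omega>"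
  shows "integrable (lebesgue_on \<Omega>) (\<lambda>x. u x * v x)"
  using L2_inner_integrable[OF assms] by simp

lemma L2_lincomb:
  assumes u: "u \<in> L2_space \<Omega>" and v: "v \<in> L2_space \<Omega>"
  shows "(\<lambda>x. a *\<^sub>R u x + b *\<^sub>R v x) \<in> L2_space \<Omega>"
proof -
  have [measurable]: "u \<in> borel_measurable (lebesgue_on \<Omega>)" "v \<in> borel_measurable (lebesgue_on \<Omega>)"
    using u v by (auto dest: L2_spaceD)
  have "(\<lambda>x. (norm (a *\<^sub>R u x + b *\<^sub>R v x))\<^sup>2) =
      (\<lambda>x. a\<^sup>2 * (u x \<bullet> u x) + 2 * a * b * (u x \<bullet> v x) + b\<^sup>2 * (v x \<bullet> v x))"
    by (simp only: power2_norm_eq_inner)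
      (simp add: inner_add_left inner_add_right inner_commute power2_eq_square algebra_simps)
  moreover have "integrable (lebesgue_on \<Omega>) \<dots>"
    using u v by (intro Bochner_Integration.integrable_add integrable_mult_right L2_inner_integrable)
  ultimately show ?thesis
    unfolding L2_space_def by (auto intro!: borel_measurable_add borel_measurable_scaleR)
qed

lemma L2_norm_le:
  assumes v: "v \<in> L2_space \<Omega>" and m: "u \<in> borel_measurable (lebesgue_on \<Omega>)"
    and le: "\<And>x. norm (u x) \<le> norm (v x)"
  shows "u \<in> L2_space \<Omega>"
proof -
  have "integrable (lebesgue_on \<Omega>) (\<lambda>x. (norm (u x))\<^sup>2)"
  proof (rule Bochner_Integration.integrable_bound[OF L2_spaceD(2)[OF v]])
    show "(\<lambda>x. (norm (u x))\<^sup>2) \<in> borel_measurable (lebesgue_on \<Omega>)"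
      using m by measurable
    show "AE x in lebesgue_on \<Omega>. norm ((norm (u x))\<^sup>2) \<le> norm ((norm (v x))\<^sup>2)"
      using le by (auto intro!: power_mono)
  qed
  with m show ?thesis by (simp add: L2_space_def)
qed

lemma borel_measurable_component:
  fixes f :: "'a \<Rightarrow> 'b::real_normed_vector ^ 'n"
  shows "f \<in> borel_measurable M \<Longrightarrow> (\<lambda>x. f x $ i) \<in> borel_measurable M"
  by (rule borel_measurable_continuous_on[of "\<lambda>y. y $ i"]) (auto intro: continuous_intros)

lemma L2_component:
  fixes u :: "'a::euclidean_space \<Rightarrow> 'b::euclidean_space ^ 'n"
  assumes "u \<in> L2_space \<Omega>"
  shows "(\<lambda>x. u x $ i) \<in> L2_space \<Omega>"
  by (rule L2_norm_le[OF assms])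
    (use assms in \<open>auto intro!: borel_measurable_component Finite_Cartesian_Product.norm_nth_le dest: L2_spaceD\<close>)

text \<open>Puts test functions and their derivatives into \<open>L2_space\<close>. Integrability
  over the compact set S is a Borel statement; it passes to Lebesgue measure as the completion, and
  then to \<Omega> by restriction.\<close>

lemma L2_compact_support:
  fixes f :: "'a::euclidean_space \<Rightarrow> 'b::euclidean_space"
  assumes f: "continuous_on UNIV f" and S: "compact S" "\<And>x. x \<notin> S \<Longrightarrow> f x = 0"
    and \<Omega>: "\<Omega> \<in> sets lebesgue"
  shows "f \<in> L2_space \<Omega>"
proof -
  have "integrable lborel (\<lambda>x. indicator S x *\<^sub>R (norm (f x))\<^sup>2)"
    using S f by (intro borel_integrable_compact continuous_intros) (auto intro: continuous_on_subset)
  also have "(\<lambda>x. indicator S x *\<^sub>R (norm (f x))\<^sup>2) = (\<lambda>x. (norm (f x))\<^sup>2)"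
    using S(2) by (force simp: indicator_def)
  finally have "integrable lebesgue (\<lambda>x. (norm (f x))\<^sup>2)"
    using f by (subst integrable_completion) (auto intro!: borel_measurable_continuous_onI continuous_intros)
  then have "integrable (lebesgue_on \<Omega>) (\<lambda>x. (norm (f x))\<^sup>2)"
    using \<Omega> by (auto simp: integrable_restrict_space intro!: integrable_mult_indicator[where 'b=real, simplified])
  moreover have "f \<in> borel_measurable (lebesgue_on \<Omega>)"
    using f \<Omega> by (intro continuous_imp_measurable_on_sets_lebesgue) (auto intro: continuous_on_subset)
  ultimately show ?thesis by (simp add: L2_space_def)
qed

text \<open>Open boxes form an intersection-stable generator of the Borel sets, and the sets over
  which f integrates to 0 are closed under complements (here \<open>i0\<close> enters) and countable
  disjoint unions. Hence f and 0 have the same integral over every Borel set, and a density is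
  unique almost everywhere.\<close>

lemma integral_zero_boxes_imp_AE_zero:
  fixes f :: "'a::euclidean_space \<Rightarrow> real"
  assumes f: "integrable lborel f" and i0: "integral\<^sup>L lborel f = 0"
    and box: "\<And>a b. (LINT x:box a b|lborel. f x) = 0"
  shows "AE x in lborel. f x = 0"
proof (rule density_unique_real[OF f])
  fix A :: "'a set" assume "A \<in> sets lborel"
  then have A: "A \<in> sigma_sets UNIV (range (\<lambda>(a, b). box a b))"
    unfolding sets_lborel borel_eq_box by simp
  have bor: "B \<in> sets borel \<longleftrightarrow> B \<in> sigma_sets UNIV (range (\<lambda>(a, b). box a b))" for B :: "'a set"
    unfolding borel_eq_box by simp
  have int: "set_integrable lborel B f" if "B \<in> sigma_sets UNIV (range (\<lambda>(a, b). box a b))" for B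
    unfolding set_integrable_def using that f by (intro integrable_mult_indicator) (auto simp: bor)
  have "Int_stable (range (\<lambda>(a, b). box a b :: 'a set))"
    by (auto simp: Int_stable_def box_Int_box)
  moreover have "range (\<lambda>(a, b). box a b :: 'a set) \<subseteq> Pow UNIV" by simp
  ultimately have "set_lebesgue_integral lborel A f = 0"
    using A
  proof (induction rule: sigma_sets_induct_disjoint)
    case (compl A)
    have "(LINT x:UNIV - A|lborel. f x) + (LINT x:A|lborel. f x) = (LINT x:UNIV|lborel. f x)"
      using int[OF compl(1)] int[OF sigma_sets.Compl[OF compl(1)]]
      by (subst set_integral_Un[symmetric]) auto
    with compl i0 show ?case by (simp add: set_lebesgue_integral_def)
  next
    case (union A)
    have "(LINT x:(\<Union>i. A i)|lborel. f x) = (\<Sum>i. (LINT x:A i|lborel. f x))"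
    proof (rule lebesgue_integral_countable_add)
      show "set_integrable lborel (\<Union>i. A i) f"
        using union bor by (intro int) (auto intro!: sigma_sets.Union)
    qed (use union bor in \<open>auto simp: disjoint_family_on_def\<close>)
    with union show ?case by simp
  qed (use box in \<open>auto simp: set_lebesgue_integral_def\<close>)
  then show "(LINT x:A|lborel. f x) = (LINT x:A|lborel. 0)" by simp
qed simp

text \<open>Bumps converge to indicators of boxes, so g integrates to 0 over every box whose closed
  box lies in \<Omega>. Truncated to one such box, g vanishes almost everywhere by the previous
  lemma, and countably many closed boxes exhaust \<Omega>.\<close>

lemma fundamental_lemma_L2:
  fixes g :: "'a::euclidean_space \<Rightarrow> real"
  assumes \<Omega>: "open \<Omega>" and g: "g \<in> L2_space \<Omega>"
    and 0: "\<And>\<phi>. test_fun \<Omega> \<phi> \<Longrightarrow> (LINT x|lebesgue_on \<Omega>. g x * \<phi> x) = 0"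
  shows "AE x in lebesgue_on \<Omega>. g x = 0"
proof -
  have \<Omega>L: "\<Omega> \<in> sets lebesgue" using \<Omega> by auto
  have gm[measurable]: "g \<in> borel_measurable (lebesgue_on \<Omega>)" using g by (rule L2_spaceD)
  have int1: "integrable (lebesgue_on \<Omega>) (\<lambda>x. g x * indicator (box a b) x)" for a b
  proof (rule L2_mult_integrable[OF g])
    have "integrable lebesgue (indicat_real (box a b))"
      using emeasure_bounded_finite[OF bounded_box, of a b]
      by (simp add: integrable_completion integrable_indicator_iff)
    then have "integrable (lebesgue_on \<Omega>) (indicat_real (box a b))"
      using \<Omega>L by (auto simp: integrable_restrict_space intro!: integrable_mult_indicator[where 'b=real, simplified])
    moreover have "(\<lambda>x. (norm (indicat_real (box a b) x))\<^sup>2) = indicat_real (box a b)"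
      by (auto simp: indicator_def)
    ultimately show "indicat_real (box a b) \<in> L2_space \<Omega>"
      by (auto simp: L2_space_def)
  qed
  have box0: "(LINT x|lebesgue_on \<Omega>. g x * indicator (box a b) x) = 0" if sub: "cbox a b \<subseteq> \<Omega>" for a b
  proof -
    have "(\<lambda>n. LINT x|lebesgue_on \<Omega>. g x * bump a b (real n) x) \<longlonglongrightarrow>
        (LINT x|lebesgue_on \<Omega>. g x * indicator (box a b) x)"
    \<comment> \<open>The absolute value of g cut off to the box dominates, because a bump has
      values between 0 and 1 and vanishes off the box.\<close>
    proof (rule integral_dominated_convergence[where w="\<lambda>x. \<bar>g x * indicator (box a b) x\<bar>"])
      have "continuous_on UNIV (bump a b (real n))" for n
        using test_fun_bump[OF sub, of "real n"] unfolding test_fun_def smooth_def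
        by (metis C_k.simps(1) of_nat_0_le_iff)
      then have [measurable]: "bump a b (real n) \<in> borel_measurable (lebesgue_on \<Omega>)" for n
        using \<Omega>L by (intro continuous_imp_measurable_on_sets_lebesgue) (auto intro: continuous_on_subset)
      show "(\<lambda>x. g x * bump a b (real n) x) \<in> borel_measurable (lebesgue_on \<Omega>)" for n
        by measurable
      show "AE x in lebesgue_on \<Omega>. norm (g x * bump a b (real n) x) \<le> \<bar>g x * indicator (box a b) x\<bar>" for n
        using bump_bounds[of a b "real n"] bump_eq_0[of "real n" _ a b]
        by (auto simp: abs_mult indicator_def mult_left_le intro!: mult_left_le)
    qed (use int1 in \<open>auto intro!: tendsto_mult bump_tendsto_indicator\<close>)
    moreover have "(LINT x|lebesgue_on \<Omega>. g x * bump a b (real n) x) = 0" for n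
      by (intro 0 test_fun_bump sub) auto
    ultimately show ?thesis
      by (simp add: LIMSEQ_const_iff)
  qed
  have local: "AE x in lebesgue. x \<in> box c d \<longrightarrow> g x = 0" if sub: "cbox c d \<subseteq> \<Omega>" for c d
  proof -
    define h where "h = (\<lambda>x. if x \<in> \<Omega> then g x * indicator (box c d) x else 0)"
    have hint: "integrable lebesgue h"
      unfolding h_def using int1[of c d] \<Omega>L by (subst Lebesgue_Measure.integrable_restrict_UNIV) auto
    \<comment> \<open>The lemma on boxes concerns Borel functions and \<open>lborel\<close>, while g
      is only Lebesgue measurable; so h is replaced by a Borel representative.\<close>
    obtain h' where h': "h' \<in> borel_measurable lborel" "AE x in lborel. h x = h' x"
      using completion_ex_borel_measurable_real[of h lborel] borel_measurable_integrable[OF hint] by blast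
    have ae: "AE x in lebesgue. h x = h' x"
      using h'(2) by (rule AE_completion)
    have h'm: "h' \<in> borel_measurable lebesgue"
      using h'(1) by (simp add: measurable_completion)
    have "integrable lebesgue h'"
      using hint ae h'm by (subst integrable_cong_AE[where g=h]) (auto intro: borel_measurable_integrable)
    then have h'int: "integrable lborel h'"
      using h'(1) by (simp add: integrable_completion)
    have boxes: "(LINT x:box a b|lborel. h' x) = 0" for a b
    proof -
      have "(LINT x:box a b|lborel. h' x) = (LINT x|lebesgue. indicator (box a b) x *\<^sub>R h' x)"
        unfolding set_lebesgue_integral_def
        using h'(1) by (subst integral_completion) auto
      also have "\<dots> = (LINT x|lebesgue. indicator (box a b) x *\<^sub>R h x)"
        using ae h'm borel_measurable_integrable[OF hint]
        by (intro integral_cong_AE borel_measurable_scaleR borel_measurable_indicator) auto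
      also have "\<dots> = (LINT x|lebesgue. (if x \<in> \<Omega> then g x * indicator (box a b \<inter> box c d) x else 0))"
        by (auto simp: h_def indicator_def intro!: Bochner_Integration.integral_cong)
      also have "\<dots> = (LINT x|lebesgue_on \<Omega>. g x * indicator (box a b \<inter> box c d) x)"
        using \<Omega>L by (rule Lebesgue_Measure.integral_restrict_UNIV)
      also have "\<dots> = 0"
      proof -
        obtain p q where pq: "box a b \<inter> box c d = box p q"
          using box_Int_box[of a b c d] by blast
        show ?thesis
        \<comment> \<open>A nonempty intersection has its closed box as closure, which stays inside
          \<open>cbox c d\<close>. For an empty one nothing is claimed about
          \<open>cbox p q\<close>, as the integrand is 0.\<close>
        proof (cases "box p q = {}")
          case False
          then have "cbox p q \<subseteq> cbox c d"
            using pq by (metis Int_lower2 box_subset_cbox closed_cbox closure_box closure_minimal order_trans)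
          with sub pq show ?thesis using box0[of p q] by auto
        qed (simp add: pq)
      qed
      finally show ?thesis .
    qed
    have "(LINT x|lborel. h' x) = (LINT x:box c d|lborel. h' x)"
      unfolding set_lebesgue_integral_def
      using h'(1) by (intro integral_cong_AE) (use h'(2) in \<open>auto simp: h_def indicator_def split: if_splits\<close>)
    then have "AE x in lborel. h' x = 0"
      using h'int boxes by (intro integral_zero_boxes_imp_AE_zero) auto
    then have "AE x in lebesgue. h' x = 0" by (rule AE_completion)
    with ae have "AE x in lebesgue. h x = 0" by eventually_elim simp
    then show ?thesis
      by eventually_elim (use sub box_subset_cbox[of c d] in \<open>auto simp: h_def split: if_splits\<close>)
  qed
  \<comment> \<open>The countable cover of \<Omega> below consists of closed boxes; their boundaries
    are null sets.\<close>
  have local': "AE x in lebesgue. x \<in> cbox c d \<longrightarrow> g x = 0" if sub: "cbox c d \<subseteq> \<Omega>" for c d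
  proof -
    have "AE x in lebesgue. x \<notin> cbox c d - box c d"
      by (rule AE_not_in) (simp add: negligible_frontier_interval flip: negligible_iff_null_sets)
    with local[OF sub] show ?thesis by eventually_elim auto
  qed
  obtain D where D: "countable D" "D \<subseteq> Pow \<Omega>" "\<And>X. X \<in> D \<Longrightarrow> \<exists>a b. X = cbox a b" "\<Union>D = \<Omega>"
    using open_countable_Union_open_cbox[OF \<Omega>] by metis
  have "AE x in lebesgue. \<forall>X\<in>D. x \<in> X \<longrightarrow> g x = 0"
    using D(1,2,3) local' by (subst AE_ball_countable) (auto, metis PowD subsetD)
  then have "AE x in lebesgue. x \<in> \<Omega> \<longrightarrow> g x = 0"
    by eventually_elim (use D(4) in auto)
  then show ?thesis
    using \<Omega>L by (subst AE_restrict_space_iff) auto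
qed

section \<open>Weak gradients\<close>

lemma frechet_derivative_outside_support:
  assumes "closed S" "\<And>x. x \<notin> S \<Longrightarrow> f x = 0" "x \<notin> S"
  shows "frechet_derivative f (at x) = (\<lambda>_. 0)"
proof (rule frechet_derivative_eqI)
  have "((\<lambda>_. 0) has_derivative (\<lambda>_. 0)) (at x)" by simp
  then show "(f has_derivative (\<lambda>_. 0)) (at x)"
    by (rule has_derivative_transform_within_open[of _ _ _ _ "- S"]) (use assms in auto)
qed

text \<open>The derivative is the pointwise limit of difference quotients with step 1 / (n + 1).
  Each quotient has integral 0 by translation invariance, the mean value theorem bounds all of them
  uniformly, and they vanish off one compact set, so dominated convergence applies.\<close>

lemma integral_frechet_derivative_eq_0:
  fixes F :: "'a::euclidean_space \<Rightarrow> real"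
  assumes F: "C_k 1 F" and S: "compact S" "\<And>x. x \<notin> S \<Longrightarrow> F x = 0" and e: "e \<in> Basis"
  shows "(LINT x|lborel. frechet_derivative F (at x) e) = 0"
proof -
  define D where "D x = frechet_derivative F (at x) e" for x
  have diff: "F differentiable at x" for x using F by simp
  have contD: "continuous_on UNIV D" using F e by (simp add: D_def)
  have contF: "continuous_on UNIV F"
    using diff by (auto intro!: continuous_at_imp_continuous_on differentiable_imp_continuous_within)
  have line: "((\<lambda>t. F (x + t *\<^sub>R e)) has_real_derivative D (x + t *\<^sub>R e)) (at t)" for x t
  proof -
    have "((\<lambda>t. x + t *\<^sub>R e) has_derivative (\<lambda>h. h *\<^sub>R e)) (at t)"
      by (auto intro!: derivative_eq_intros)
    moreover have "(F has_derivative frechet_derivative F (at (x + t *\<^sub>R e))) (at (x + t *\<^sub>R e))"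
      using diff by (simp add: frechet_derivative_works)
    ultimately have "((\<lambda>t. F (x + t *\<^sub>R e)) has_derivative
        (\<lambda>h. frechet_derivative F (at (x + t *\<^sub>R e)) (h *\<^sub>R e))) (at t)"
      by (rule has_derivative_compose)
    moreover have "linear (frechet_derivative F (at (x + t *\<^sub>R e)))"
      using diff by (intro linear_frechet_derivative)
    then have "(\<lambda>h. frechet_derivative F (at (x + t *\<^sub>R e)) (h *\<^sub>R e)) = (*) (D (x + t *\<^sub>R e))"
      by (auto simp: D_def linear_scale)
    ultimately show ?thesis
      by (simp add: has_field_derivative_def)
  qed
  have D0: "D x = 0" if "x \<notin> S" for x
    using frechet_derivative_outside_support[of S F x] S that by (simp add: D_def compact_imp_closed)
  obtain B where B: "\<And>x. \<bar>D x\<bar> \<le> B" "0 \<le> B"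
  proof -
    have "bounded (D ` S)"
      using contD S(1) by (intro compact_imp_bounded compact_continuous_image) (auto intro: continuous_on_subset)
    then obtain B where "\<And>x. x \<in> S \<Longrightarrow> \<bar>D x\<bar> \<le> B" "B > 0"
      unfolding bounded_pos by auto
    then show ?thesis using D0 that by (metis abs_zero less_imp_le)
  qed
  define q where "q n x = (F (x + inverse (real (Suc n)) *\<^sub>R e) - F x) / inverse (real (Suc n))" for n x
  \<comment> \<open>T contains the supports of all quotients: a point where \<open>q n\<close> does
    not vanish is carried into S by some shift \<open>t *\<^sub>R e\<close> with t between 0 and
    1.\<close>
  define T where "T = (\<lambda>(y, t). y - t *\<^sub>R e) ` (S \<times> {0..1})"
  have T: "compact T"
    unfolding T_def using S(1)
    by (intro compact_continuous_image compact_Times) (auto simp: case_prod_unfold intro!: continuous_intros)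
  have qb: "\<bar>q n x\<bar> \<le> B" for n x
  proof -
    have "\<exists>z::real>0. z < inverse (real (Suc n)) \<and>
        F (x + inverse (real (Suc n)) *\<^sub>R e) - F (x + 0 *\<^sub>R e) = (inverse (real (Suc n)) - 0) * D (x + z *\<^sub>R e)"
      using line by (intro MVT2) auto
    then obtain z where "F (x + inverse (real (Suc n)) *\<^sub>R e) - F x = inverse (real (Suc n)) * D (x + z *\<^sub>R e)"
      by auto
    then have "q n x = D (x + z *\<^sub>R e)" unfolding q_def by simp
    then show ?thesis using B(1) by simp
  qed
  have q0: "q n x = 0" if "x \<notin> T" for n x
  proof -
    have "x + t *\<^sub>R e \<notin> S" if "t \<in> {0..1}" for t
    proof
      assume "x + t *\<^sub>R e \<in> S"
      with that have "(\<lambda>(y, t). y - t *\<^sub>R e) (x + t *\<^sub>R e, t) \<in> T"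
        unfolding T_def by (intro imageI) auto
      with \<open>x \<notin> T\<close> show False by simp
    qed
    from this[of 0] this[of "inverse (real (Suc n))"] show ?thesis
      using S(2) by (simp add: q_def inverse_le_1_iff)
  qed
  have Fint: "integrable lborel F"
  proof -
    have "integrable lborel (\<lambda>x. indicator S x *\<^sub>R F x)"
      using S contF by (intro borel_integrable_compact) (auto intro: continuous_on_subset)
    moreover have "(\<lambda>x. indicator S x *\<^sub>R F x) = F" using S(2) by (force simp: indicator_def)
    ultimately show ?thesis by simp
  qed
  have [measurable]: "F \<in> borel_measurable borel"
    using contF by (rule borel_measurable_continuous_onI)
  have qint: "integral\<^sup>L lborel (q n) = 0" for n
  proof -
    let ?c = "inverse (real (Suc n)) *\<^sub>R e"
    have *: "integrable lborel (\<lambda>x. F (?c + x))" "(LINT x|lborel. F (?c + x)) = integral\<^sup>L lborel F"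
      using Fint integrable_distr_eq[of "(+) ?c" lborel borel F] integral_distr[of "(+) ?c" lborel borel F]
      by (simp_all add: lborel_distr_plus)
    then have "(LINT x|lborel. F (?c + x) - F x) = 0"
      using Fint by simp
    moreover have "integral\<^sup>L lborel (q n) = (LINT x|lborel. F (?c + x) - F x) / inverse (real (Suc n))"
      unfolding q_def[abs_def] integral_divide_zero by (simp add: add.commute)
    ultimately show ?thesis by simp
  qed
  have "(\<lambda>n. integral\<^sup>L lborel (q n)) \<longlonglongrightarrow> integral\<^sup>L lborel D"
  proof (rule integral_dominated_convergence[where w="\<lambda>x. indicator T x * B"])
    show "D \<in> borel_measurable lborel"
      using contD by (simp add: borel_measurable_continuous_onI)
    show "q n \<in> borel_measurable lborel" for n
      unfolding q_def by measurable
    show "integrable lborel (\<lambda>x. indicator T x * B)"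
      using borel_integrable_compact[OF T, of "\<lambda>_. B"] by simp
    show "AE x in lborel. norm (q n x) \<le> indicator T x * B" for n
      using qb q0 B(2) by (auto simp: indicator_def)
    have "(\<lambda>n. q n x) \<longlonglongrightarrow> D x" for x
    proof -
      have "((\<lambda>h. (F (x + h *\<^sub>R e) - F x) / h) \<longlongrightarrow> D x) (at 0)"
        using line[of x 0] by (simp add: has_field_derivative_iff)
      moreover have "filterlim (\<lambda>n. inverse (real (Suc n))) (at 0) sequentially"
        by (use LIMSEQ_inverse_real_of_nat in \<open>auto simp: filterlim_at\<close>)
      ultimately show ?thesis
        unfolding q_def by (rule filterlim_compose)
    qed
    then show "AE x in lborel. (\<lambda>n. q n x) \<longlonglongrightarrow> D x" by simp
  qed
  then show ?thesis
    by (simp add: qint LIMSEQ_const_iff D_def[abs_def])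
qed

text \<open>Returns an integral over \<Omega> to the whole space, where translations act; continuity
  gives the Borel measurability needed to leave the completion.\<close>

lemma integral_lebesgue_on_eq_lborel:
  fixes f :: "'a::euclidean_space \<Rightarrow> real"
  assumes "continuous_on UNIV f" "\<And>x. x \<notin> \<Omega> \<Longrightarrow> f x = 0" "\<Omega> \<in> sets lebesgue"
  shows "(LINT x|lebesgue_on \<Omega>. f x) = (LINT x|lborel. f x)"
proof -
  have "(LINT x|lebesgue_on \<Omega>. f x) = (LINT x|lebesgue. (if x \<in> \<Omega> then f x else 0))"
    using assms by (simp add: Lebesgue_Measure.integral_restrict_UNIV)
  also have "(\<lambda>x. if x \<in> \<Omega> then f x else 0) = f"
    using assms(2) by auto
  also have "integral\<^sup>L lebesgue f = integral\<^sup>L lborel f"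
    using assms(1) by (intro integral_completion) (simp add: borel_measurable_continuous_onI)
  finally show ?thesis .
qed

lemma test_funD:
  assumes "test_fun \<Omega> \<phi>"
  shows "C_k k \<phi>" "\<And>x. \<phi> differentiable at x" "continuous_on UNIV \<phi>"
    "e \<in> Basis \<Longrightarrow> continuous_on UNIV (\<lambda>x. frechet_derivative \<phi> (at x) e)"
    "compact (closure {x. \<phi> x \<noteq> 0})" "closure {x. \<phi> x \<noteq> 0} \<subseteq> \<Omega>"
    "x \<notin> closure {x. \<phi> x \<noteq> 0} \<Longrightarrow> \<phi> x = 0"
    "x \<notin> closure {x. \<phi> x \<noteq> 0} \<Longrightarrow> frechet_derivative \<phi> (at x) e = 0"
proof -
  have C: "C_k k \<phi>" for k using assms by (simp add: test_fun_def smooth_def)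
  then show "C_k k \<phi>" .
  show "\<phi> differentiable at x" for x using C[of 1] by simp
  show "continuous_on UNIV \<phi>" using C[of 0] by simp
  show "e \<in> Basis \<Longrightarrow> continuous_on UNIV (\<lambda>x. frechet_derivative \<phi> (at x) e)" using C[of 1] by simp
  show "compact (closure {x. \<phi> x \<noteq> 0})" "closure {x. \<phi> x \<noteq> 0} \<subseteq> \<Omega>"
    using assms by (auto simp: test_fun_def)
  have 0: "\<phi> x = 0" if "x \<notin> closure {x. \<phi> x \<noteq> 0}" for x
    using that closure_subset[of "{x. \<phi> x \<noteq> 0}"] by auto
  then show "x \<notin> closure {x. \<phi> x \<noteq> 0} \<Longrightarrow> \<phi> x = 0" .
  show "frechet_derivative \<phi> (at x) e = 0" if x: "x \<notin> closure {x. \<phi> x \<noteq> 0}"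
    by (rule fun_cong[OF frechet_derivative_outside_support[of "closure {x. \<phi> x \<noteq> 0}", OF closed_closure 0 x]])
qed

lemma test_fun_L2:
  fixes \<phi> :: "'a::euclidean_space \<Rightarrow> 'b::euclidean_space"
  assumes "test_fun \<Omega> \<phi>" "\<Omega> \<in> sets lebesgue"
  shows "\<phi> \<in> L2_space \<Omega>"
    and "e \<in> Basis \<Longrightarrow> (\<lambda>x. frechet_derivative \<phi> (at x) e) \<in> L2_space \<Omega>"
proof -
  note D = test_funD[OF assms(1)]
  show "\<phi> \<in> L2_space \<Omega>"
    by (rule L2_compact_support[OF D(3) D(5) D(7) assms(2)])
  show "(\<lambda>x. frechet_derivative \<phi> (at x) e) \<in> L2_space \<Omega>" if "e \<in> Basis"
    by (rule L2_compact_support[OF D(4)[OF that] D(5) D(8) assms(2)])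
qed

lemma axis_1_in_Basis: "axis j (1::real) \<in> Basis"
  by (auto simp: Basis_vec_def)

text \<open>For each entry, the partial derivative of \<open>\<phi> x $ i * \<psi> x\<close>
  integrates to 0 over the whole space, hence over \<Omega>, which contains the support of \<psi>.
  The product rule splits it into the two sides of the defining identity.\<close>

lemma test_fun_weak_grad:
  fixes \<phi> :: "real^'d \<Rightarrow> real^'d"
  assumes \<phi>: "test_fun \<Omega> \<phi>" and \<Omega>: "\<Omega> \<in> sets lebesgue"
  defines "g \<equiv> \<lambda>x. (\<chi> i j. frechet_derivative \<phi> (at x) (axis j 1) $ i)"
  shows "g \<in> L2_space \<Omega>" "is_weak_grad \<Omega> \<phi> g"
proof -
  note D = test_funD[OF \<phi>]
  show "g \<in> L2_space \<Omega>"
  proof (rule L2_compact_support[OF _ D(5) _ \<Omega>])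
    show "continuous_on UNIV g"
      unfolding g_def using D(4) axis_1_in_Basis
      by (intro continuous_on_vec_lambda continuous_on_component) auto
    show "g x = 0" if "x \<notin> closure {x. \<phi> x \<noteq> 0}" for x
      using D(8)[OF that] by (simp add: g_def vec_eq_iff)
  qed
  show "is_weak_grad \<Omega> \<phi> g"
    unfolding is_weak_grad_def
  proof (intro allI impI)
    fix \<psi> :: "real^'d \<Rightarrow> real" and i j :: 'd
    assume \<psi>: "test_fun \<Omega> \<psi>"
    note E = test_funD[OF \<psi>]
    let ?e = "axis j (1::real)"
    have lin: "bounded_linear (\<lambda>y::real^'d. y $ i)"
      by (simp add: bounded_linear_vec_nth)
    have C1: "C_k 1 (\<lambda>x. \<phi> x $ i * \<psi> x)"
      by (rule C_k_mult[OF C_k_linear[OF lin D(1)] E(1)])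
    have d: "frechet_derivative (\<lambda>x. \<phi> x $ i * \<psi> x) (at x) ?e =
        \<phi> x $ i * frechet_derivative \<psi> (at x) ?e + g x $ i $ j * \<psi> x" for x
    proof -
      have "((\<lambda>x. \<phi> x $ i) has_derivative (\<lambda>e. frechet_derivative \<phi> (at x) e $ i)) (at x)"
        using D(2)[of x] by (intro bounded_linear.has_derivative[OF lin]) (simp add: frechet_derivative_works)
      moreover have "(\<psi> has_derivative frechet_derivative \<psi> (at x)) (at x)"
        using E(2)[of x] by (simp add: frechet_derivative_works)
      ultimately have "((\<lambda>x. \<phi> x $ i * \<psi> x) has_derivative
          (\<lambda>e. \<phi> x $ i * frechet_derivative \<psi> (at x) e + frechet_derivative \<phi> (at x) e $ i * \<psi> x)) (at x)"
        by (rule has_derivative_mult)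
      from frechet_derivative_eqI[OF this] show ?thesis by (simp add: g_def)
    qed
    have "0 = (LINT x|lborel. frechet_derivative (\<lambda>x. \<phi> x $ i * \<psi> x) (at x) ?e)"
      by (rule integral_frechet_derivative_eq_0[symmetric, OF C1 E(5) _ axis_1_in_Basis])
         (drule E(7), simp)
    also have "\<dots> = (LINT x|lebesgue_on \<Omega>. frechet_derivative (\<lambda>x. \<phi> x $ i * \<psi> x) (at x) ?e)"
    proof (rule integral_lebesgue_on_eq_lborel[symmetric])
      show "continuous_on UNIV (\<lambda>x. frechet_derivative (\<lambda>x. \<phi> x $ i * \<psi> x) (at x) ?e)"
        using C1 axis_1_in_Basis[of j] by simp
      show "frechet_derivative (\<lambda>x. \<phi> x $ i * \<psi> x) (at x) ?e = 0" if "x \<notin> \<Omega>" for x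
      proof -
        have "x \<notin> closure {x. \<psi> x \<noteq> 0}" using E(6) that by blast
        from E(7)[OF this] E(8)[OF this] show ?thesis unfolding d by simp
      qed
    qed fact
    also have "\<dots> = (LINT x|lebesgue_on \<Omega>. \<phi> x $ i * frechet_derivative \<psi> (at x) ?e)
                  + (LINT x|lebesgue_on \<Omega>. g x $ i $ j * \<psi> x)"
      unfolding d
      using \<open>g \<in> L2_space \<Omega>\<close> test_fun_L2(1)[OF \<phi> \<Omega>] test_fun_L2(1)[OF \<psi> \<Omega>]
        test_fun_L2(2)[OF \<psi> \<Omega> axis_1_in_Basis[of j]]
      by (intro Bochner_Integration.integral_add L2_mult_integrable L2_component)
    finally show "(LINT x|lebesgue_on \<Omega>. \<phi> x $ i * frechet_derivative \<psi> (at x) ?e) =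
        - (LINT x|lebesgue_on \<Omega>. g x $ i $ j * \<psi> x)" by simp
  qed
qed

section \<open>Linearity and uniqueness of weak gradients\<close>

lemma is_weak_grad_lincomb:
  assumes \<Omega>: "\<Omega> \<in> sets lebesgue"
    and u: "u \<in> L2_space \<Omega>" "g \<in> L2_space \<Omega>" "is_weak_grad \<Omega> u g"
    and v: "v \<in> L2_space \<Omega>" "h \<in> L2_space \<Omega>" "is_weak_grad \<Omega> v h"
  shows "is_weak_grad \<Omega> (\<lambda>x. a *\<^sub>R u x + b *\<^sub>R v x) (\<lambda>x. a *\<^sub>R g x + b *\<^sub>R h x)"
  unfolding is_weak_grad_def
proof (intro allI impI)
  fix \<psi> :: "real^'a \<Rightarrow> real" and i j :: 'a
  assume \<psi>: "test_fun \<Omega> \<psi>"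
  note L = test_fun_L2[OF \<psi> \<Omega>] 
  let ?D = "\<lambda>x. frechet_derivative \<psi> (at x) (axis j 1)"
  have comb: "(LINT x|lebesgue_on \<Omega>. (a * p x + b * q x) * r x) =
      a * (LINT x|lebesgue_on \<Omega>. p x * r x) + b * (LINT x|lebesgue_on \<Omega>. q x * r x)"
    if "p \<in> L2_space \<Omega>" "q \<in> L2_space \<Omega>" "r \<in> L2_space \<Omega>" for p q r :: "real^'a \<Rightarrow> real"
  proof -
    have "(\<lambda>x. (a * p x + b * q x) * r x) = (\<lambda>x. a * (p x * r x) + b * (q x * r x))"
      by (simp add: algebra_simps)
    then show ?thesis
      using that by (simp add: L2_mult_integrable)
  qed
  have "(LINT x|lebesgue_on \<Omega>. (a *\<^sub>R u x + b *\<^sub>R v x) $ i * ?D x) =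
      a * (LINT x|lebesgue_on \<Omega>. u x $ i * ?D x) + b * (LINT x|lebesgue_on \<Omega>. v x $ i * ?D x)"
    using u v L axis_1_in_Basis[of j] by (simp add: comb L2_component)
  also have "\<dots> = - (a * (LINT x|lebesgue_on \<Omega>. g x $ i $ j * \<psi> x) + b * (LINT x|lebesgue_on \<Omega>. h x $ i $ j * \<psi> x))"
    using u(3) v(3) \<psi> unfolding is_weak_grad_def by (simp add: algebra_simps)
  also have "\<dots> = - (LINT x|lebesgue_on \<Omega>. (a *\<^sub>R g x + b *\<^sub>R h x) $ i $ j * \<psi> x)"
    using u v L by (simp add: comb L2_component)
  finally show "(LINT x|lebesgue_on \<Omega>. (a *\<^sub>R u x + b *\<^sub>R v x) $ i * ?D x) =
      - (LINT x|lebesgue_on \<Omega>. (a *\<^sub>R g x + b *\<^sub>R h x) $ i $ j * \<psi> x)" .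
qed

text \<open>The fundamental lemma is applied to each entry of the difference. This makes the choice
  in \<open>grad\<close> harmless: any weak gradient that can be exhibited agrees with it almost
  everywhere.\<close>

lemma is_weak_grad_unique:
  assumes \<Omega>: "open \<Omega>" and g: "g \<in> L2_space \<Omega>" "is_weak_grad \<Omega> u g"
    and h: "h \<in> L2_space \<Omega>" "is_weak_grad \<Omega> u h"
  shows "ae_eq \<Omega> g h"
proof -
  have "AE x in lebesgue_on \<Omega>. g x $ i $ j - h x $ i $ j = 0" for i j :: 'a
  proof (rule fundamental_lemma_L2[OF \<Omega>])
    have L: "(\<lambda>x. g x $ i $ j) \<in> L2_space \<Omega>" "(\<lambda>x. h x $ i $ j) \<in> L2_space \<Omega>"
      using g h by (auto intro!: L2_component)
    then show "(\<lambda>x. g x $ i $ j - h x $ i $ j) \<in> L2_space \<Omega>"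
      using L2_lincomb[of "\<lambda>x. g x $ i $ j" \<Omega> "\<lambda>x. h x $ i $ j" 1 "-1"] by simp
    fix \<psi> :: "real^'a \<Rightarrow> real" assume \<psi>: "test_fun \<Omega> \<psi>"
    have "(LINT x|lebesgue_on \<Omega>. g x $ i $ j * \<psi> x) = (LINT x|lebesgue_on \<Omega>. h x $ i $ j * \<psi> x)"
      using g(2)[unfolded is_weak_grad_def, rule_format, OF \<psi>, of i j]
        h(2)[unfolded is_weak_grad_def, rule_format, OF \<psi>, of i j] by simp
    then show "(LINT x|lebesgue_on \<Omega>. (g x $ i $ j - h x $ i $ j) * \<psi> x) = 0"
      using L test_fun_L2(1)[OF \<psi>] \<Omega> by (simp add: left_diff_distrib L2_mult_integrable)
  qed
  then have "AE x in lebesgue_on \<Omega>. \<forall>i j. g x $ i $ j - h x $ i $ j = 0"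
    by (simp add: AE_all_countable)
  then show ?thesis
    unfolding ae_eq_def by eventually_elim (simp add: vec_eq_iff)
qed

lemma is_weak_grad_cong:
  assumes "ae_eq \<Omega> u v" "u \<in> L2_space \<Omega>" "v \<in> L2_space \<Omega>" "\<Omega> \<in> sets lebesgue"
  shows "is_weak_grad \<Omega> u g \<longleftrightarrow> is_weak_grad \<Omega> v g"
proof -
  have "(LINT x|lebesgue_on \<Omega>. u x $ i * frechet_derivative \<psi> (at x) (axis j 1)) =
      (LINT x|lebesgue_on \<Omega>. v x $ i * frechet_derivative \<psi> (at x) (axis j 1))"
    if \<psi>: "test_fun \<Omega> \<psi>" for \<psi> :: "real^'a \<Rightarrow> real" and i j :: 'a
    using assms test_fun_L2(2)[OF \<psi> assms(4) axis_1_in_Basis[of j]] unfolding ae_eq_def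
    by (intro integral_cong_AE borel_measurable_times borel_measurable_component)
       (auto dest: L2_spaceD)
  then show ?thesis by (simp add: is_weak_grad_def)
qed

section \<open>The L2 inner product and its seminorm\<close>

lemma l2_inner_commute: "l2_inner \<Omega> u v = l2_inner \<Omega> v u"
  by (simp add: l2_inner_def inner_commute)

lemma l2_inner_self_nonneg: "0 \<le> l2_inner \<Omega> u u"
  by (simp add: l2_inner_def)

lemma l2_norm_nonneg: "0 \<le> l2_norm \<Omega> u"
  by (simp add: l2_norm_def l2_inner_self_nonneg)

lemma l2_norm_power2: "(l2_norm \<Omega> u)\<^sup>2 = l2_inner \<Omega> u u"
  by (simp add: l2_norm_def l2_inner_self_nonneg)

lemma l2_inner_lincomb_left:
  assumes "u \<in> L2_space \<Omega>" "v \<in> L2_space \<Omega>" "w \<in> L2_space \<Omega>"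
  shows "l2_inner \<Omega> (\<lambda>x. a *\<^sub>R u x + b *\<^sub>R v x) w = a * l2_inner \<Omega> u w + b * l2_inner \<Omega> v w"
  using assms by (simp add: l2_inner_def inner_add_left L2_inner_integrable)

lemma l2_inner_lincomb_right:
  assumes "u \<in> L2_space \<Omega>" "v \<in> L2_space \<Omega>" "w \<in> L2_space \<Omega>"
  shows "l2_inner \<Omega> w (\<lambda>x. a *\<^sub>R u x + b *\<^sub>R v x) = a * l2_inner \<Omega> w u + b * l2_inner \<Omega> w v"
  using l2_inner_lincomb_left[OF assms] by (simp add: l2_inner_commute[of _ w])

lemma l2_inner_cong:
  assumes "ae_eq \<Omega> u u'" "ae_eq \<Omega> v v'"
    and "u \<in> L2_space \<Omega>" "u' \<in> L2_space \<Omega>" "v \<in> L2_space \<Omega>" "v' \<in> L2_space \<Omega>"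
  shows "l2_inner \<Omega> u v = l2_inner \<Omega> u' v'"
  unfolding l2_inner_def using assms
  by (intro integral_cong_AE borel_measurable_inner) (auto simp: ae_eq_def dest: L2_spaceD)

lemma l2_norm_cong:
  "ae_eq \<Omega> u v \<Longrightarrow> u \<in> L2_space \<Omega> \<Longrightarrow> v \<in> L2_space \<Omega> \<Longrightarrow> l2_norm \<Omega> u = l2_norm \<Omega> v"
  unfolding l2_norm_def by (simp add: l2_inner_cong[of \<Omega> u v u v])

lemma l2_norm_lincomb_power2:
  assumes "u \<in> L2_space \<Omega>" "v \<in> L2_space \<Omega>"
  shows "(l2_norm \<Omega> (\<lambda>x. a *\<^sub>R u x + b *\<^sub>R v x))\<^sup>2 =
    a\<^sup>2 * (l2_norm \<Omega> u)\<^sup>2 + 2 * a * b * l2_inner \<Omega> u v + b\<^sup>2 * (l2_norm \<Omega> v)\<^sup>2"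
  unfolding l2_norm_power2 using assms
  by (simp add: l2_inner_lincomb_left l2_inner_lincomb_right L2_lincomb
      l2_inner_commute[of _ v u] power2_eq_square algebra_simps)

text \<open>On functions \<open>l2_inner\<close> is only semidefinite, so the inequality is read off
  the nonnegative quadratic form in the coefficients a and b, with v of norm 0 treated
  apart.\<close>

lemma l2_Cauchy_Schwarz:
  assumes "u \<in> L2_space \<Omega>" "v \<in> L2_space \<Omega>"
  shows "\<bar>l2_inner \<Omega> u v\<bar> \<le> l2_norm \<Omega> u * l2_norm \<Omega> v"
proof -
  let ?A = "(l2_norm \<Omega> u)\<^sup>2" and ?B = "l2_inner \<Omega> u v" and ?C = "(l2_norm \<Omega> v)\<^sup>2"
  have pos: "0 \<le> a\<^sup>2 * ?A + 2 * a * b * ?B + b\<^sup>2 * ?C" for a b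
    using l2_norm_lincomb_power2[OF assms, of a b] by (metis zero_le_power2)
  have "?B\<^sup>2 \<le> ?A * ?C"
  proof (cases "?C = 0")
    case True
    have "?B = 0"
    proof (rule ccontr)
      assume B: "?B \<noteq> 0"
      \<comment> \<open>Without the square term the form is affine in b, and this b makes its value
        -1.\<close>
      have "0 \<le> ?A + 2 * (- (?A + 1) / (2 * ?B)) * ?B"
        using pos[of 1 "- (?A + 1) / (2 * ?B)"] True by simp
      also have "\<dots> = - 1" using B by (simp add: field_simps)
      finally show False by simp
    qed
    with True show ?thesis by simp
  next
    case False
    then have C: "?C > 0" by (metis less_eq_real_def zero_le_power2)
    \<comment> \<open>The coefficients C and -B are, up to the factor C, those of the combination u
      - (B / C) v of least norm.\<close>
    have "0 \<le> ?C * (?C * ?A - ?B\<^sup>2)"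
      using pos[of ?C "- ?B"] by (simp add: power2_eq_square algebra_simps)
    with C have "0 \<le> ?C * ?A - ?B\<^sup>2" using zero_le_mult_iff[of ?C "?C * ?A - ?B\<^sup>2"] by linarith
    then show ?thesis by (simp add: mult.commute)
  qed
  then have "?B\<^sup>2 \<le> (l2_norm \<Omega> u * l2_norm \<Omega> v)\<^sup>2" by (simp add: power_mult_distrib)
  then show ?thesis
    by (simp add: abs_le_square_iff[symmetric] l2_norm_nonneg)
qed

lemma l2_norm_lincomb_le:
  assumes "u \<in> L2_space \<Omega>" "v \<in> L2_space \<Omega>"
  shows "l2_norm \<Omega> (\<lambda>x. a *\<^sub>R u x + b *\<^sub>R v x) \<le> \<bar>a\<bar> * l2_norm \<Omega> u + \<bar>b\<bar> * l2_norm \<Omega> v"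
proof (rule power2_le_imp_le)
  have "a * b * l2_inner \<Omega> u v \<le> \<bar>a * b\<bar> * (l2_norm \<Omega> u * l2_norm \<Omega> v)"
    using mult_left_mono[OF l2_Cauchy_Schwarz[OF assms], of "\<bar>a * b\<bar>"]
      abs_ge_self[of "a * b * l2_inner \<Omega> u v"] by (simp add: abs_mult mult.assoc)
  then show "(l2_norm \<Omega> (\<lambda>x. a *\<^sub>R u x + b *\<^sub>R v x))\<^sup>2 \<le> (\<bar>a\<bar> * l2_norm \<Omega> u + \<bar>b\<bar> * l2_norm \<Omega> v)\<^sup>2"
    unfolding l2_norm_lincomb_power2[OF assms]
    by (simp add: power2_sum power_mult_distrib abs_mult algebra_simps)
qed (simp add: l2_norm_nonneg)

section \<open>Linear structure of the Sobolev spaces\<close>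

lemma H1_L2: "u \<in> H1_space \<Omega> \<Longrightarrow> u \<in> L2_space \<Omega>"
  by (simp add: H1_space_def)

lemma H1_grad:
  assumes "u \<in> H1_space \<Omega>"
  shows "grad \<Omega> u \<in> L2_space \<Omega>" "is_weak_grad \<Omega> u (grad \<Omega> u)"
proof -
  have "\<exists>g. g \<in> L2_space \<Omega> \<and> is_weak_grad \<Omega> u g" using assms by (auto simp: H1_space_def)
  then have "grad \<Omega> u \<in> L2_space \<Omega> \<and> is_weak_grad \<Omega> u (grad \<Omega> u)"
    unfolding grad_def by (rule someI_ex)
  then show "grad \<Omega> u \<in> L2_space \<Omega>" "is_weak_grad \<Omega> u (grad \<Omega> u)" by auto
qed

lemma H1_lincomb:
  assumes \<Omega>: "open \<Omega>" and u: "u \<in> H1_space \<Omega>" and v: "v \<in> H1_space \<Omega>"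
  shows "(\<lambda>x. a *\<^sub>R u x + b *\<^sub>R v x) \<in> H1_space \<Omega>"
proof -
  have "is_weak_grad \<Omega> (\<lambda>x. a *\<^sub>R u x + b *\<^sub>R v x) (\<lambda>x. a *\<^sub>R grad \<Omega> u x + b *\<^sub>R grad \<Omega> v x)"
    using \<Omega> H1_L2[OF u] H1_grad[OF u] H1_L2[OF v] H1_grad[OF v] by (intro is_weak_grad_lincomb) auto
  with u v show ?thesis
    unfolding H1_space_def using L2_lincomb[OF H1_grad(1)[OF u] H1_grad(1)[OF v], of a b]
    by (auto intro!: L2_lincomb)
qed

text \<open>The combination w is an arbitrary representative, since the relations between the
  iterates hold only almost everywhere.\<close>

lemma grad_lincomb:
  assumes \<Omega>: "open \<Omega>" and u: "u \<in> H1_space \<Omega>" and v: "v \<in> H1_space \<Omega>" and w: "w \<in> H1_space \<Omega>"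
    and eq: "ae_eq \<Omega> w (\<lambda>x. a *\<^sub>R u x + b *\<^sub>R v x)"
  shows "ae_eq \<Omega> (grad \<Omega> w) (\<lambda>x. a *\<^sub>R grad \<Omega> u x + b *\<^sub>R grad \<Omega> v x)"
proof (rule is_weak_grad_unique[OF \<Omega> H1_grad[OF w]])
  have \<Omega>L: "\<Omega> \<in> sets lebesgue" using \<Omega> by auto
  have "is_weak_grad \<Omega> (\<lambda>x. a *\<^sub>R u x + b *\<^sub>R v x) (\<lambda>x. a *\<^sub>R grad \<Omega> u x + b *\<^sub>R grad \<Omega> v x)"
    using \<Omega>L H1_L2[OF u] H1_grad[OF u] H1_L2[OF v] H1_grad[OF v] by (rule is_weak_grad_lincomb)
  then show "is_weak_grad \<Omega> w (\<lambda>x. a *\<^sub>R grad \<Omega> u x + b *\<^sub>R grad \<Omega> v x)"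
    using is_weak_grad_cong[OF eq H1_L2[OF w] L2_lincomb[OF H1_L2[OF u] H1_L2[OF v]] \<Omega>L] by simp
  show "(\<lambda>x. a *\<^sub>R grad \<Omega> u x + b *\<^sub>R grad \<Omega> v x) \<in> L2_space \<Omega>"
    by (rule L2_lincomb[OF H1_grad(1)[OF u] H1_grad(1)[OF v]])
qed

lemma test_fun_H1:
  fixes \<phi> :: "real^'d \<Rightarrow> real^'d"
  assumes "open \<Omega>" "test_fun \<Omega> \<phi>"
  shows "\<phi> \<in> H1_space \<Omega>"
proof -
  have "\<Omega> \<in> sets lebesgue" using assms(1) by auto
  from test_fun_L2(1)[OF assms(2) this] test_fun_weak_grad[OF assms(2) this]
  show ?thesis unfolding H1_space_def by blast
qed

lemma test_fun_lincomb:
  assumes \<phi>: "test_fun \<Omega> \<phi>" and \<psi>: "test_fun \<Omega> \<psi>"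
  shows "test_fun \<Omega> (\<lambda>x. a *\<^sub>R \<phi> x + b *\<^sub>R \<psi> x)"
proof -
  let ?S = "closure {x. \<phi> x \<noteq> 0} \<union> closure {x. \<psi> x \<noteq> 0}"
  have S: "compact ?S" "?S \<subseteq> \<Omega>"
    using test_funD(5,6)[OF \<phi>] test_funD(5,6)[OF \<psi>] by auto
  have sub: "closure {x. a *\<^sub>R \<phi> x + b *\<^sub>R \<psi> x \<noteq> 0} \<subseteq> ?S"
  proof (rule closure_minimal)
    show "{x. a *\<^sub>R \<phi> x + b *\<^sub>R \<psi> x \<noteq> 0} \<subseteq> ?S"
    proof (rule subsetI, rule ccontr)
      fix x assume x: "x \<in> {x. a *\<^sub>R \<phi> x + b *\<^sub>R \<psi> x \<noteq> 0}" "x \<notin> ?S"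
      then have "\<phi> x = 0" "\<psi> x = 0"
        by (blast intro: test_funD(7)[OF \<phi>] test_funD(7)[OF \<psi>])+
      with x(1) show False by simp
    qed
    show "closed ?S" by (intro closed_Un closed_closure)
  qed
  have "C_k k (\<lambda>x. a *\<^sub>R \<phi> x + b *\<^sub>R \<psi> x)" for k
    by (intro C_k_add C_k_linear[OF bounded_linear_scaleR_right] test_funD(1)[OF \<phi>] test_funD(1)[OF \<psi>])
  with sub S show ?thesis
    unfolding test_fun_def smooth_def
    by (meson bounded_subset closed_closure compact_eq_bounded_closed order_trans)
qed

lemma H10_H1: "u \<in> H10_space \<Omega> \<Longrightarrow> u \<in> H1_space \<Omega>"
  by (simp add: H10_space_def)

lemma h1_norm_ge: "l2_norm \<Omega> u \<le> h1_norm \<Omega> u" "l2_norm \<Omega> (grad \<Omega> u) \<le> h1_norm \<Omega> u"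
  unfolding h1_norm_def by (auto intro!: real_le_rsqrt)

text \<open>The factor 2 comes from bounding the L2 part and the gradient part separately and adding
  them; it is harmless when passing to a limit 0.\<close>

lemma h1_norm_lincomb_le:
  assumes \<Omega>: "open \<Omega>" and u: "u \<in> H1_space \<Omega>" and v: "v \<in> H1_space \<Omega>"
  shows "h1_norm \<Omega> (\<lambda>x. a *\<^sub>R u x + b *\<^sub>R v x) \<le> 2 * (\<bar>a\<bar> * h1_norm \<Omega> u + \<bar>b\<bar> * h1_norm \<Omega> v)"
proof -
  let ?w = "\<lambda>x. a *\<^sub>R u x + b *\<^sub>R v x"
  have w: "?w \<in> H1_space \<Omega>" using \<Omega> u v by (rule H1_lincomb)
  note g = H1_grad(1)[OF u] H1_grad(1)[OF v]
  have "ae_eq \<Omega> (grad \<Omega> ?w) (\<lambda>x. a *\<^sub>R grad \<Omega> u x + b *\<^sub>R grad \<Omega> v x)"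
    using \<Omega> u v w by (rule grad_lincomb) (simp add: ae_eq_def)
  then have "l2_norm \<Omega> (grad \<Omega> ?w) = l2_norm \<Omega> (\<lambda>x. a *\<^sub>R grad \<Omega> u x + b *\<^sub>R grad \<Omega> v x)"
    using g H1_grad(1)[OF w] by (intro l2_norm_cong L2_lincomb)
  also have "\<dots> \<le> \<bar>a\<bar> * l2_norm \<Omega> (grad \<Omega> u) + \<bar>b\<bar> * l2_norm \<Omega> (grad \<Omega> v)"
    using g by (rule l2_norm_lincomb_le)
  also have "\<dots> \<le> \<bar>a\<bar> * h1_norm \<Omega> u + \<bar>b\<bar> * h1_norm \<Omega> v"
    by (intro add_mono mult_left_mono h1_norm_ge) auto
  finally have 1: "l2_norm \<Omega> (grad \<Omega> ?w) \<le> \<bar>a\<bar> * h1_norm \<Omega> u + \<bar>b\<bar> * h1_norm \<Omega> v" .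
  have "l2_norm \<Omega> ?w \<le> \<bar>a\<bar> * l2_norm \<Omega> u + \<bar>b\<bar> * l2_norm \<Omega> v"
    using H1_L2[OF u] H1_L2[OF v] by (rule l2_norm_lincomb_le)
  also have "\<dots> \<le> \<bar>a\<bar> * h1_norm \<Omega> u + \<bar>b\<bar> * h1_norm \<Omega> v"
    by (intro add_mono mult_left_mono h1_norm_ge) auto
  finally have 2: "l2_norm \<Omega> ?w \<le> \<bar>a\<bar> * h1_norm \<Omega> u + \<bar>b\<bar> * h1_norm \<Omega> v" .
  have "h1_norm \<Omega> ?w \<le> l2_norm \<Omega> ?w + l2_norm \<Omega> (grad \<Omega> ?w)"
    unfolding h1_norm_def by (rule sqrt_sum_squares_le_sum) (simp_all add: l2_norm_nonneg)
  with 1 2 show ?thesis by simp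
qed

text \<open>The same combination of the two approximating sequences approximates the combination of
  the limits. The norm estimate asks for the differences \<open>\<phi> n - u\<close> to lie in
  \<open>H1_space\<close>, which is where \<open>test_fun_H1\<close> enters.\<close>

lemma H10_lincomb:
  assumes \<Omega>: "open \<Omega>" and u: "u \<in> H10_space \<Omega>" and v: "v \<in> H10_space \<Omega>"
  shows "(\<lambda>x. a *\<^sub>R u x + b *\<^sub>R v x) \<in> H10_space \<Omega>"
proof -
  from u obtain \<phi> where \<phi>: "\<And>n::nat. test_fun \<Omega> (\<phi> n)" "(\<lambda>n. h1_norm \<Omega> (\<lambda>x. \<phi> n x - u x)) \<longlonglongrightarrow> 0"
    by (auto simp: H10_space_def)
  from v obtain \<psi> where \<psi>: "\<And>n::nat. test_fun \<Omega> (\<psi> n)" "(\<lambda>n. h1_norm \<Omega> (\<lambda>x. \<psi> n x - v x)) \<longlonglongrightarrow> 0"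
    by (auto simp: H10_space_def)
  have diff: "(\<lambda>x. p x - q x) \<in> H1_space \<Omega>" if "p \<in> H1_space \<Omega>" "q \<in> H1_space \<Omega>" for p q
    using H1_lincomb[OF \<Omega> that, of 1 "-1"] by simp
  have le: "h1_norm \<Omega> (\<lambda>x. (a *\<^sub>R \<phi> n x + b *\<^sub>R \<psi> n x) - (a *\<^sub>R u x + b *\<^sub>R v x)) \<le>
      2 * (\<bar>a\<bar> * h1_norm \<Omega> (\<lambda>x. \<phi> n x - u x) + \<bar>b\<bar> * h1_norm \<Omega> (\<lambda>x. \<psi> n x - v x))" for n
  proof -
    have "(\<lambda>x. (a *\<^sub>R \<phi> n x + b *\<^sub>R \<psi> n x) - (a *\<^sub>R u x + b *\<^sub>R v x)) =
        (\<lambda>x. a *\<^sub>R (\<phi> n x - u x) + b *\<^sub>R (\<psi> n x - v x))"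
      by (simp add: algebra_simps)
    then show ?thesis
      using h1_norm_lincomb_le[OF \<Omega> diff[OF test_fun_H1[OF \<Omega> \<phi>(1)] H10_H1[OF u]]
        diff[OF test_fun_H1[OF \<Omega> \<psi>(1)] H10_H1[OF v]], of a n b n] by simp
  qed
  have "(\<lambda>n. h1_norm \<Omega> (\<lambda>x. (a *\<^sub>R \<phi> n x + b *\<^sub>R \<psi> n x) - (a *\<^sub>R u x + b *\<^sub>R v x))) \<longlonglongrightarrow> 0"
  proof (rule tendsto_sandwich[OF _ _ tendsto_const])
    show "(\<lambda>n. 2 * (\<bar>a\<bar> * h1_norm \<Omega> (\<lambda>x. \<phi> n x - u x) + \<bar>b\<bar> * h1_norm \<Omega> (\<lambda>x. \<psi> n x - v x))) \<longlonglongrightarrow> 0"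
      using \<phi>(2) \<psi>(2) by (auto intro!: tendsto_eq_intros)
    show "\<forall>\<^sub>F n in sequentially. 0 \<le> h1_norm \<Omega> (\<lambda>x. (a *\<^sub>R \<phi> n x + b *\<^sub>R \<psi> n x) - (a *\<^sub>R u x + b *\<^sub>R v x))"
      by (simp add: h1_norm_def)
  qed (use le in auto)
  moreover have "test_fun \<Omega> (\<lambda>x. a *\<^sub>R \<phi> n x + b *\<^sub>R \<psi> n x)" for n
    by (rule test_fun_lincomb[OF \<phi>(1) \<psi>(1)])
  ultimately show ?thesis
    using H1_lincomb[OF \<Omega> H10_H1[OF u] H10_H1[OF v], of a b] unfolding H10_space_def
    by (auto intro!: exI[of _ "\<lambda>n x. a *\<^sub>R \<phi> n x + b *\<^sub>R \<psi> n x"])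
qed

section \<open>The constant of the residual estimate\<close>

text \<open>The surplus power of s is absorbed by K. The bound by K is conditional because it will
  be obtained by dividing by s; at s = 0 both sides vanish, whatever the sign of K.\<close>

lemma powr_three_halves:
  fixes s :: real
  assumes "0 \<le> s" "s \<noteq> 0 \<Longrightarrow> s \<le> K"
  shows "s\<^sup>2 \<le> K powr (1/2) * s powr (3/2)" "s ^ 4 \<le> K powr (5/2) * s powr (3/2)"
proof -
  consider "s = 0" | "0 < s" "s \<le> K" using assms by linarith
  then have "s\<^sup>2 \<le> K powr (1/2) * s powr (3/2) \<and> s ^ 4 \<le> K powr (5/2) * s powr (3/2)"
  proof cases
    case 2
    have "s\<^sup>2 = s powr (1/2) * s powr (3/2)" "s ^ 4 = s powr (5/2) * s powr (3/2)"
      using 2 by (simp_all flip: powr_add add: powr_numeral)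
    then show ?thesis
      using 2 by (auto intro!: mult_right_mono powr_mono2)
  qed simp
  then show "s\<^sup>2 \<le> K powr (1/2) * s powr (3/2)" "s ^ 4 \<le> K powr (5/2) * s powr (3/2)" by auto
qed

text \<open>\<open>D\<close> is the stability constant of the linearized problem, \<open>K\<close>
  bounds a nonzero residual of a Newton step from the ball, and \<open>c\<close> bounds the ratio of
  the older residual to the newer one. The two summands collect the terms of order 2 and 4 in the
  residual.\<close>

definition residual_constant :: "real \<Rightarrow> real \<Rightarrow> real \<Rightarrow> real \<Rightarrow> real \<Rightarrow> real" where
  "residual_constant \<nu> M R F \<alpha> = (let
      D = M / (\<nu> - M * R);
      K = (F + M * R\<^sup>2 + \<nu> * R) / (\<nu> - M * R);
      c = (1 + \<bar>1 - \<alpha>\<bar>) / \<bar>\<alpha>\<bar>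
    in D * (\<bar>1 - \<alpha>\<bar> + \<bar>\<alpha>\<bar> * c\<^sup>2) * K powr (1/2)
      + D * \<bar>\<alpha> * (1 - \<alpha>)\<bar> * (D * (1 + c\<^sup>2))\<^sup>2 * K powr (5/2))"

text \<open>The part of the estimate that concerns real numbers only: s, p, w, z stand for the
  gradient norms of \<open>y k\<close>, of \<open>y (k - 1)\<close>, of the difference of the two
  Newton updates, and of \<open>y (k + 1)\<close>.\<close>

lemma residual_scalar_bound:
  fixes s p w z :: real
  assumes s: "0 \<le> s" "s \<noteq> 0 \<Longrightarrow> s \<le> (F + M * R\<^sup>2 + \<nu> * R) / (\<nu> - M * R)"
    and p: "0 \<le> p" "p \<le> (1 + \<bar>1 - \<alpha>\<bar>) / \<bar>\<alpha>\<bar> * s"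
    and w: "0 \<le> w" "w \<le> M / (\<nu> - M * R) * (s\<^sup>2 + p\<^sup>2)"
    and z: "z \<le> M / (\<nu> - M * R) * (\<bar>1 - \<alpha>\<bar> * s\<^sup>2 + \<bar>\<alpha>\<bar> * p\<^sup>2 + \<bar>\<alpha> * (1 - \<alpha>)\<bar> * w\<^sup>2)"
    and D: "0 \<le> M / (\<nu> - M * R)"
  shows "z \<le> residual_constant \<nu> M R F \<alpha> * s powr (3/2)"
proof -
  define D where "D = M / (\<nu> - M * R)"
  define K where "K = (F + M * R\<^sup>2 + \<nu> * R) / (\<nu> - M * R)"
  define c where "c = (1 + \<bar>1 - \<alpha>\<bar>) / \<bar>\<alpha>\<bar>"
  have "0 \<le> D" using assms(8) by (simp add: D_def)
  have p2: "p\<^sup>2 \<le> c\<^sup>2 * s\<^sup>2"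
    using power_mono[OF p(2) p(1), of 2] by (simp only: c_def power_mult_distrib)
  have "w \<le> D * (s\<^sup>2 + c\<^sup>2 * s\<^sup>2)"
    using w(2) mult_left_mono[OF p2 \<open>0 \<le> D\<close>] by (simp add: D_def[symmetric] algebra_simps)
  then have "w \<le> D * (1 + c\<^sup>2) * s\<^sup>2" by (simp add: algebra_simps)
  then have w2: "w\<^sup>2 \<le> (D * (1 + c\<^sup>2))\<^sup>2 * s ^ 4"
    using power_mono[OF _ w(1), of _ 2] by (fastforce simp: power_mult_distrib)
  have "z \<le> D * (\<bar>1 - \<alpha>\<bar> * s\<^sup>2 + \<bar>\<alpha>\<bar> * p\<^sup>2 + \<bar>\<alpha> * (1 - \<alpha>)\<bar> * w\<^sup>2)"
    using z by (simp add: D_def)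
  also have "\<dots> \<le> D * (\<bar>1 - \<alpha>\<bar> * s\<^sup>2 + \<bar>\<alpha>\<bar> * (c\<^sup>2 * s\<^sup>2) + \<bar>\<alpha> * (1 - \<alpha>)\<bar> * ((D * (1 + c\<^sup>2))\<^sup>2 * s ^ 4))"
    using \<open>0 \<le> D\<close> by (intro mult_left_mono add_mono p2 w2) auto
  also have "\<dots> = D * (\<bar>1 - \<alpha>\<bar> + \<bar>\<alpha>\<bar> * c\<^sup>2) * s\<^sup>2 + D * \<bar>\<alpha> * (1 - \<alpha>)\<bar> * (D * (1 + c\<^sup>2))\<^sup>2 * s ^ 4"
    by (simp only: algebra_simps)
  also have "\<dots> \<le> D * (\<bar>1 - \<alpha>\<bar> + \<bar>\<alpha>\<bar> * c\<^sup>2) * (K powr (1/2) * s powr (3/2))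
      + D * \<bar>\<alpha> * (1 - \<alpha>)\<bar> * (D * (1 + c\<^sup>2))\<^sup>2 * (K powr (5/2) * s powr (3/2))"
    using \<open>0 \<le> D\<close> s unfolding K_def
    by (intro add_mono mult_left_mono powr_three_halves) auto
  also have "\<dots> = residual_constant \<nu> M R F \<alpha> * s powr (3/2)"
    unfolding residual_constant_def Let_def D_def[symmetric] K_def[symmetric] c_def[symmetric]
    by (simp only: algebra_simps)
  finally show ?thesis .
qed

section \<open>The trilinear form and Newton steps\<close>

locale continuous_trilinear_form =
  fixes \<Omega> :: "(real^'d) set" and M :: real
  assumes open_domain: "open \<Omega>" and bound: "bform_bound \<Omega> M"
begin

abbreviation H where "H \<equiv> H10_space \<Omega>"
abbreviation b where "b \<equiv> bform \<Omega>"
abbreviation gnorm where "gnorm u \<equiv> l2_norm \<Omega> (grad \<Omega> u)"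
abbreviation ginner where "ginner u v \<equiv> l2_inner \<Omega> (grad \<Omega> u) (grad \<Omega> v)"

text \<open>A relation instead of an equation between functions, as the iterates are determined only
  almost everywhere; it carries the memberships in H along, so that a single premise feeds each
  linearity lemma.\<close>

definition lincomb where
  "lincomb p \<beta> u \<gamma> v \<longleftrightarrow> p \<in> H \<and> u \<in> H \<and> v \<in> H \<and> ae_eq \<Omega> p (\<lambda>x. \<beta> *\<^sub>R u x + \<gamma> *\<^sub>R v x)"

lemma lincombI: "u \<in> H \<Longrightarrow> v \<in> H \<Longrightarrow> lincomb (\<lambda>x. \<beta> *\<^sub>R u x + \<gamma> *\<^sub>R v x) \<beta> u \<gamma> v"
  by (simp add: lincomb_def H10_lincomb open_domain ae_eq_def)

lemma lincomb_grad:
  assumes "lincomb p \<beta> u \<gamma> v"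
  shows "ae_eq \<Omega> (grad \<Omega> p) (\<lambda>x. \<beta> *\<^sub>R grad \<Omega> u x + \<gamma> *\<^sub>R grad \<Omega> v x)"
  using assms unfolding lincomb_def by (auto intro!: grad_lincomb open_domain H10_H1)

lemma grad_L2: "u \<in> H \<Longrightarrow> grad \<Omega> u \<in> L2_space \<Omega>"
  by (simp add: H10_H1 H1_grad)

lemma ginner_lincomb_left:
  assumes l: "lincomb p \<beta> u \<gamma> v" and w: "w \<in> H"
  shows "ginner p w = \<beta> * ginner u w + \<gamma> * ginner v w"
proof -
  have H: "p \<in> H" "u \<in> H" "v \<in> H" using l by (auto simp: lincomb_def)
  have "ginner p w = l2_inner \<Omega> (\<lambda>x. \<beta> *\<^sub>R grad \<Omega> u x + \<gamma> *\<^sub>R grad \<Omega> v x) (grad \<Omega> w)"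
    using H w by (intro l2_inner_cong lincomb_grad[OF l] L2_lincomb grad_L2) (simp_all add: ae_eq_def)
  then show ?thesis using H w by (simp add: l2_inner_lincomb_left grad_L2)
qed

lemma ginner_lincomb_right:
  "lincomb p \<beta> u \<gamma> v \<Longrightarrow> w \<in> H \<Longrightarrow> ginner w p = \<beta> * ginner w u + \<gamma> * ginner w v"
  using ginner_lincomb_left by (metis l2_inner_commute)

lemma gnorm_power2: "(gnorm u)\<^sup>2 = ginner u u"
  by (rule l2_norm_power2)

lemma ginner_le: "u \<in> H \<Longrightarrow> v \<in> H \<Longrightarrow> \<bar>ginner u v\<bar> \<le> gnorm u * gnorm v"
  by (intro l2_Cauchy_Schwarz grad_L2)

lemma gnorm_lincomb:
  assumes l: "lincomb p \<beta> u \<gamma> v"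
  shows "gnorm p \<le> \<bar>\<beta>\<bar> * gnorm u + \<bar>\<gamma>\<bar> * gnorm v"
proof -
  have H: "p \<in> H" "u \<in> H" "v \<in> H" using l by (auto simp: lincomb_def)
  have "gnorm p = l2_norm \<Omega> (\<lambda>x. \<beta> *\<^sub>R grad \<Omega> u x + \<gamma> *\<^sub>R grad \<Omega> v x)"
    using H by (intro l2_norm_cong lincomb_grad[OF l] L2_lincomb grad_L2)
  then show ?thesis using l2_norm_lincomb_le[OF grad_L2 grad_L2] H by simp
qed

text \<open>A null function is almost everywhere 0 v + 0 v, so \<open>gnorm_lincomb\<close> bounds
  its norm by 0.\<close>

lemma gnorm_ae_zero:
  assumes "v \<in> H" "ae_eq \<Omega> v (\<lambda>_. 0)"
  shows "gnorm v = 0"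
  using gnorm_lincomb[of v 0 v 0 v] assms l2_norm_nonneg[of \<Omega> "grad \<Omega> v"] by (simp add: lincomb_def)

lemma M_pos: "M > 0"
  using bound by (simp add: bform_bound_def)

text \<open>The form before skew-symmetrization. Its linearity in each slot is a pointwise identity
  under the integral, and \<open>b\<close> inherits it.\<close>

definition T where "T u v w = l2_inner \<Omega> (convect \<Omega> u v) w"

lemma b_eq: "b u v w = (T u v w - T u w v) / 2"
  by (simp add: bform_def T_def)

lemma T_integrable: "u \<in> H \<Longrightarrow> v \<in> H \<Longrightarrow> w \<in> H \<Longrightarrow> integrable (lebesgue_on \<Omega>) (\<lambda>x. convect \<Omega> u v x \<bullet> w x)"
  using bound by (simp add: bform_bound_def)

text \<open>The integrability clause of \<open>bform_bound\<close> enters here: it makes the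
  integral additive and provides measurability of the integrands.\<close>

lemma T_lincombI:
  assumes "AE x in lebesgue_on \<Omega>. convect \<Omega> u v x \<bullet> w x =
      \<beta> * (convect \<Omega> u1 v1 x \<bullet> w1 x) + \<gamma> * (convect \<Omega> u2 v2 x \<bullet> w2 x)"
    and "{u, v, w, u1, v1, w1, u2, v2, w2} \<subseteq> H"
  shows "T u v w = \<beta> * T u1 v1 w1 + \<gamma> * T u2 v2 w2"
proof -
  have i: "integrable (lebesgue_on \<Omega>) (\<lambda>x. convect \<Omega> u v x \<bullet> w x)"
    "integrable (lebesgue_on \<Omega>) (\<lambda>x. convect \<Omega> u1 v1 x \<bullet> w1 x)"
    "integrable (lebesgue_on \<Omega>) (\<lambda>x. convect \<Omega> u2 v2 x \<bullet> w2 x)"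
    using assms(2) by (auto intro!: T_integrable)
  have "T u v w = (LINT x|lebesgue_on \<Omega>. \<beta> * (convect \<Omega> u1 v1 x \<bullet> w1 x) + \<gamma> * (convect \<Omega> u2 v2 x \<bullet> w2 x))"
    unfolding T_def l2_inner_def
  proof (rule integral_cong_AE)
    show "(\<lambda>x. convect \<Omega> u v x \<bullet> w x) \<in> borel_measurable (lebesgue_on \<Omega>)"
      using i(1) by (rule borel_measurable_integrable)
    show "(\<lambda>x. \<beta> * (convect \<Omega> u1 v1 x \<bullet> w1 x) + \<gamma> * (convect \<Omega> u2 v2 x \<bullet> w2 x)) \<in> borel_measurable (lebesgue_on \<Omega>)"
      using i(2,3) by (intro borel_measurable_integrable) auto
  qed (rule assms(1))
  then show ?thesis
    using i(2,3) by (simp add: T_def l2_inner_def)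
qed

lemma T_lincomb1:
  assumes "lincomb p \<beta> u \<gamma> v" "w \<in> H" "z \<in> H"
  shows "T p w z = \<beta> * T u w z + \<gamma> * T v w z"
proof (rule T_lincombI)
  have "AE x in lebesgue_on \<Omega>. p x = \<beta> *\<^sub>R u x + \<gamma> *\<^sub>R v x"
    using assms(1) by (simp add: lincomb_def ae_eq_def)
  then show "AE x in lebesgue_on \<Omega>. convect \<Omega> p w x \<bullet> z x =
      \<beta> * (convect \<Omega> u w x \<bullet> z x) + \<gamma> * (convect \<Omega> v w x \<bullet> z x)"
    by eventually_elim
      (simp add: convect_def matrix_vector_right_distrib matrix_vector_mult_scaleR inner_add_left)
qed (use assms in \<open>auto simp: lincomb_def\<close>)

lemma T_lincomb2:
  assumes "lincomb p \<beta> u \<gamma> v" "w \<in> H" "z \<in> H"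
  shows "T w p z = \<beta> * T w u z + \<gamma> * T w v z"
proof (rule T_lincombI)
  have "AE x in lebesgue_on \<Omega>. grad \<Omega> p x = \<beta> *\<^sub>R grad \<Omega> u x + \<gamma> *\<^sub>R grad \<Omega> v x"
    using lincomb_grad[OF assms(1)] by (simp add: ae_eq_def)
  then show "AE x in lebesgue_on \<Omega>. convect \<Omega> w p x \<bullet> z x =
      \<beta> * (convect \<Omega> w u x \<bullet> z x) + \<gamma> * (convect \<Omega> w v x \<bullet> z x)"
    by eventually_elim
      (simp add: convect_def matrix_vector_mult_add_rdistrib scaleR_matrix_vector_assoc[symmetric] inner_add_left)
qed (use assms in \<open>auto simp: lincomb_def\<close>)

lemma T_lincomb3:
  assumes "lincomb p \<beta> u \<gamma> v" "w \<in> H" "z \<in> H"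
  shows "T w z p = \<beta> * T w z u + \<gamma> * T w z v"
proof (rule T_lincombI)
  have "AE x in lebesgue_on \<Omega>. p x = \<beta> *\<^sub>R u x + \<gamma> *\<^sub>R v x"
    using assms(1) by (simp add: lincomb_def ae_eq_def)
  then show "AE x in lebesgue_on \<Omega>. convect \<Omega> w z x \<bullet> p x =
      \<beta> * (convect \<Omega> w z x \<bullet> u x) + \<gamma> * (convect \<Omega> w z x \<bullet> v x)"
    by eventually_elim (simp add: inner_add_right)
qed (use assms in \<open>auto simp: lincomb_def\<close>)

lemma b_lincomb1:
  "lincomb p \<beta> u \<gamma> v \<Longrightarrow> w \<in> H \<Longrightarrow> z \<in> H \<Longrightarrow> b p w z = \<beta> * b u w z + \<gamma> * b v w z"
  unfolding b_eq using T_lincomb1[of p \<beta> u \<gamma> v w z] T_lincomb1[of p \<beta> u \<gamma> v z w]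
  by (simp add: field_simps)

lemma b_lincomb2:
  "lincomb p \<beta> u \<gamma> v \<Longrightarrow> w \<in> H \<Longrightarrow> z \<in> H \<Longrightarrow> b w p z = \<beta> * b w u z + \<gamma> * b w v z"
  unfolding b_eq using T_lincomb2[of p \<beta> u \<gamma> v w z] T_lincomb3[of p \<beta> u \<gamma> v w z]
  by (simp add: field_simps)

lemma b_lincomb3:
  "lincomb p \<beta> u \<gamma> v \<Longrightarrow> w \<in> H \<Longrightarrow> z \<in> H \<Longrightarrow> b w z p = \<beta> * b w z u + \<gamma> * b w z v"
  unfolding b_eq using T_lincomb2[of p \<beta> u \<gamma> v w z] T_lincomb3[of p \<beta> u \<gamma> v w z]
  by (simp add: field_simps)

lemma b_same: "b u v v = 0"
  by (simp add: bform_def)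

text \<open>Exchanging the last two arguments flips the sign, so the one-sided bound yields the
  lower one too.\<close>

lemma b_abs_le:
  assumes "u \<in> H" "v \<in> H" "w \<in> H"
  shows "\<bar>b u v w\<bar> \<le> M * gnorm u * gnorm v * gnorm w"
proof -
  have "b u v w \<le> M * gnorm u * gnorm v * gnorm w" "b u w v \<le> M * gnorm u * gnorm w * gnorm v"
    using bound assms by (auto simp: bform_bound_def)
  moreover have "b u w v = - b u v w" by (simp add: b_eq field_simps)
  ultimately show ?thesis by (simp add: mult_ac abs_le_iff)
qed

section \<open>The forcing and single Newton steps\<close>

lemma dual_norm_bound:
  assumes f: "forcing \<Omega> f" and v: "v \<in> H"
  shows "f v \<le> dual_norm \<Omega> f * gnorm v"
proof -
  obtain K where K: "\<And>v. v \<in> H \<Longrightarrow> \<bar>f v\<bar> \<le> K * gnorm v"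
    using f unfolding forcing_def by blast
  show ?thesis
  proof (cases "gnorm v = 0")
    case True
    then show ?thesis using K[OF v] by simp
  next
    case False
    then have pos: "gnorm v > 0" using l2_norm_nonneg[of \<Omega> "grad \<Omega> v"] by linarith
    have "f v / gnorm v \<le> dual_norm \<Omega> f"
      unfolding dual_norm_def
    proof (rule cSUP_upper)
      show "v \<in> {v \<in> H. \<not> ae_eq \<Omega> v (\<lambda>_. 0)}"
        using v False gnorm_ae_zero by auto
      \<comment> \<open>The sign of K is unknown, and \<open>max K 0\<close> also bounds the
        quotient when \<open>gnorm w = 0\<close>, which is 0 by the convention for division.\<close>
      have "f w / gnorm w \<le> max K 0" if "w \<in> H" for w
      proof (cases "gnorm w = 0")
        case False
        then have "gnorm w > 0" using l2_norm_nonneg[of \<Omega> "grad \<Omega> w"] by linarith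
        then have "K * gnorm w \<le> max K 0 * gnorm w"
          by (intro mult_right_mono) auto
        then have "f w \<le> max K 0 * gnorm w" using K[OF that] by linarith
        with \<open>gnorm w > 0\<close> show ?thesis by (simp add: pos_divide_le_eq)
      qed simp
      then show "bdd_above ((\<lambda>v. f v / gnorm v) ` {v \<in> H. \<not> ae_eq \<Omega> v (\<lambda>_. 0)})"
        by (auto intro!: bdd_aboveI2)
    qed
    with pos show ?thesis by (simp add: field_simps)
  qed
qed

text \<open>The first identity determines the increment y from the residual at u. The second is the
  exact Newton remainder: the equation is quadratic, so g solves it up to
  \<open>b y y v\<close>.\<close>

lemma newton_step_residual:
  assumes n: "is_newton_step \<Omega> V \<nu> f u g" and V: "V \<subseteq> H" "u \<in> V" "v \<in> V"
    and g: "lincomb g 1 u 1 y"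
  shows "b u y v + b y u v + \<nu> * ginner y v = f v - b u u v - \<nu> * ginner u v"
    and "b g g v + \<nu> * ginner g v = f v + b y y v"
proof -
  have H: "u \<in> H" "v \<in> H" "g \<in> H" "y \<in> H" using V g by (auto simp: lincomb_def)
  have eq: "b u g v + b g u v - b u u v + \<nu> * ginner g v = f v"
    using n V(3) by (auto simp: is_newton_step_def)
  have e: "b u g v = b u u v + b u y v" "b g u v = b u u v + b y u v"
    "ginner g v = ginner u v + ginner y v"
    using b_lincomb2[OF g] b_lincomb1[OF g] ginner_lincomb_left[OF g] H by auto
  show "b u y v + b y u v + \<nu> * ginner y v = f v - b u u v - \<nu> * ginner u v"
    using eq unfolding e by (simp add: algebra_simps)
  have "b g g v = b g u v + b g y v" "b g y v = b u y v + b y y v"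
    using b_lincomb2[OF g] b_lincomb1[OF g] H by auto
  with eq e show "b g g v + \<nu> * ginner g v = f v + b y y v"
    by (simp add: algebra_simps)
qed

text \<open>This is the linearization at u tested with y: its term \<open>b u y y\<close> vanishes
  by skew-symmetry, and \<open>b y u y\<close> costs at most M R times the squared norm.\<close>

lemma coercivity:
  assumes "u \<in> H" "y \<in> H" "gnorm u \<le> R"
  shows "(\<nu> - M * R) * (gnorm y)\<^sup>2 \<le> b y u y + \<nu> * ginner y y"
proof -
  have "- b y u y \<le> M * gnorm y * gnorm u * gnorm y"
    using b_abs_le[of y u y] assms by simp
  also have "\<dots> = M * (gnorm y)\<^sup>2 * gnorm u" by (simp add: power2_eq_square)
  also have "\<dots> \<le> M * (gnorm y)\<^sup>2 * R"
    using assms(3) M_pos by (intro mult_left_mono) auto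
  finally show ?thesis by (simp add: gnorm_power2[symmetric] algebra_simps)
qed

text \<open>Supplies the \<open>K\<close> of \<open>residual_constant\<close>. The increment
  equation is tested with y, and one factor \<open>gnorm y\<close> is cancelled, whence the
  assumption that it is nonzero.\<close>

lemma newton_residual_bound:
  assumes n: "is_newton_step \<Omega> V \<nu> f u g" and V: "V \<subseteq> H" "u \<in> V" "y \<in> V" and g: "lincomb g 1 u 1 y"
    and R: "gnorm u \<le> R" "M * R < \<nu>" and f: "forcing \<Omega> f" and "\<nu> > 0" and y: "gnorm y \<noteq> 0"
  shows "gnorm y \<le> (dual_norm \<Omega> f + M * R\<^sup>2 + \<nu> * R) / (\<nu> - M * R)"
proof -
  have H: "u \<in> H" "y \<in> H" using V by auto
  have ypos: "gnorm y > 0" using y l2_norm_nonneg[of \<Omega> "grad \<Omega> y"] by linarith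
  have "(\<nu> - M * R) * (gnorm y)\<^sup>2 \<le> f y - b u u y - \<nu> * ginner u y"
    using coercivity[OF H R(1), of \<nu>] newton_step_residual(1)[OF n V g] by (simp add: b_same)
  also have "\<dots> \<le> dual_norm \<Omega> f * gnorm y + M * R\<^sup>2 * gnorm y + \<nu> * R * gnorm y"
  proof -
    have "- b u u y \<le> M * (gnorm u)\<^sup>2 * gnorm y"
      using b_abs_le[of u u y] H by (simp add: power2_eq_square mult.assoc)
    also have "\<dots> \<le> M * R\<^sup>2 * gnorm y"
      using R(1) M_pos by (intro mult_right_mono mult_left_mono power_mono) (auto simp: l2_norm_nonneg)
    finally have 1: "- b u u y \<le> M * R\<^sup>2 * gnorm y" .
    have "\<nu> * (- ginner u y) \<le> \<nu> * (R * gnorm y)"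
    proof (rule mult_left_mono)
      have "- ginner u y \<le> gnorm u * gnorm y" using ginner_le[OF H] by simp
      also have "\<dots> \<le> R * gnorm y" using R(1) by (intro mult_right_mono) (auto simp: l2_norm_nonneg)
      finally show "- ginner u y \<le> R * gnorm y" .
    qed (use \<open>\<nu> > 0\<close> in simp)
    with 1 dual_norm_bound[OF f H(2)] show ?thesis by simp
  qed
  finally have "((\<nu> - M * R) * gnorm y) * gnorm y \<le> (dual_norm \<Omega> f + M * R\<^sup>2 + \<nu> * R) * gnorm y"
    by (simp add: power2_eq_square algebra_simps)
  then have "(\<nu> - M * R) * gnorm y \<le> dual_norm \<Omega> f + M * R\<^sup>2 + \<nu> * R"
    using ypos by simp
  with R(2) show ?thesis by (simp add: field_simps)
qed

text \<open>Shared last step of the two energy estimates below; for a vanishing norm the claim rests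
  on \<open>0 \<le> c\<close>.\<close>

lemma cancel_gnorm:
  assumes "\<delta> > 0" "\<delta> * (gnorm w)\<^sup>2 \<le> M * c * gnorm w" "0 \<le> c"
  shows "gnorm w \<le> M / \<delta> * c"
proof (cases "gnorm w = 0")
  case True
  with assms M_pos show ?thesis by simp
next
  case False
  then have "gnorm w > 0" using l2_norm_nonneg[of \<Omega> "grad \<Omega> w"] by linarith
  moreover have "(\<delta> * gnorm w) * gnorm w \<le> (M * c) * gnorm w"
    using assms(2) by (simp add: power2_eq_square mult.assoc)
  ultimately have "\<delta> * gnorm w \<le> M * c" by simp
  with assms(1) show ?thesis by (simp add: field_simps)
qed

lemma abs_b_diag_le: "u \<in> H \<Longrightarrow> v \<in> H \<Longrightarrow> \<bar>b u u v\<bar> \<le> M * (gnorm u)\<^sup>2 * gnorm v"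
  using b_abs_le[of u u v] by (simp add: power2_eq_square mult.assoc)

text \<open>
  The test function \<open>w\<close> is the difference of \<open>g\<close> and \<open>g'\<close>, so \<open>b w u w\<close> does not depend on which
  affine combination \<open>u\<close> of \<open>g\<close> and \<open>g'\<close> is used; hence only the averaged iterate has to be small.
\<close>

lemma newton_difference_bound:
  assumes V: "V \<subseteq> H" "g \<in> V" "g' \<in> V" and y: "y \<in> H" "y' \<in> H"
    and g: "\<And>v. v \<in> V \<Longrightarrow> b g g v + \<nu> * ginner g v = f v + b y y v"
    and g': "\<And>v. v \<in> V \<Longrightarrow> b g' g' v + \<nu> * ginner g' v = f v + b y' y' v"
    and w: "lincomb w 1 g (-1) g'" and u: "lincomb u (1 - \<alpha>) g \<alpha> g'"
    and R: "gnorm u \<le> R" "M * R < \<nu>"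
  shows "gnorm w \<le> M / (\<nu> - M * R) * ((gnorm y)\<^sup>2 + (gnorm y')\<^sup>2)"
proof (rule cancel_gnorm)
  have H: "g \<in> H" "g' \<in> H" "w \<in> H" "u \<in> H" using V w u by (auto simp: lincomb_def)
  have d: "b g g v - b g' g' v + \<nu> * ginner w v = b y y v - b y' y' v" if "v \<in> V" for v
  proof -
    have "ginner w v = ginner g v - ginner g' v"
      using ginner_lincomb_left[OF w, of v] that V by auto
    then have "\<nu> * ginner w v = \<nu> * ginner g v - \<nu> * ginner g' v"
      by (simp add: right_diff_distrib)
    with g[OF that] g'[OF that] show ?thesis by linarith
  qed
  \<comment> \<open>As w is not known to lie in V, which is merely a subset of H here, the equation
    is tested with g and with g' and the results are subtracted.\<close>
  have *: "b g g w - b g' g' w + \<nu> * ginner w w = b y y w - b y' y' w"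
    using d[OF V(2)] d[OF V(3)] H y
    by (simp add: b_lincomb3[OF w] ginner_lincomb_right[OF w H(3)] algebra_simps)
  have "b g g w - b g' g' w = b w u w"
  proof -
    \<comment> \<open>That \<open>b g w w\<close> vanishes turns the difference into
      \<open>b w g' w\<close>; that \<open>b w w w\<close> vanishes then allows u in place of
      g'.\<close>
    have "b g w w = b g g w - b g g' w" "b w g' w = b g g' w - b g' g' w"
      "b w w w = b w g w - b w g' w" "b w u w = (1 - \<alpha>) * b w g w + \<alpha> * b w g' w"
      using b_lincomb2[OF w] b_lincomb1[OF w] b_lincomb2[OF u] H by auto
    then show ?thesis by (simp add: b_same algebra_simps)
  qed
  then have "(\<nu> - M * R) * (gnorm w)\<^sup>2 \<le> b y y w - b y' y' w"
    using coercivity[OF H(4,3) R(1), of \<nu>] * by simp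
  also have "\<dots> \<le> M * ((gnorm y)\<^sup>2 + (gnorm y')\<^sup>2) * gnorm w"
    using abs_b_diag_le[OF y(1) H(3)] abs_b_diag_le[OF y(2) H(3)] by (simp add: algebra_simps)
  finally show "(\<nu> - M * R) * (gnorm w)\<^sup>2 \<le> M * ((gnorm y)\<^sup>2 + (gnorm y')\<^sup>2) * gnorm w" .
qed (use R in auto)

lemma accelerated_residual_bound:
  assumes V: "V \<subseteq> H" "u \<in> V" "z \<in> V" and y: "y \<in> H" "y' \<in> H"
    and g: "\<And>v. v \<in> V \<Longrightarrow> b g g v + \<nu> * ginner g v = f v + b y y v"
    and g': "\<And>v. v \<in> V \<Longrightarrow> b g' g' v + \<nu> * ginner g' v = f v + b y' y' v"
    and w: "lincomb w 1 g (-1) g'" and u: "lincomb u (1 - \<alpha>) g \<alpha> g'"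
    and n: "is_newton_step \<Omega> V \<nu> f u gz" and z: "lincomb gz 1 u 1 z"
    and R: "gnorm u \<le> R" "M * R < \<nu>"
  shows "gnorm z \<le> M / (\<nu> - M * R) *
    (\<bar>1 - \<alpha>\<bar> * (gnorm y)\<^sup>2 + \<bar>\<alpha>\<bar> * (gnorm y')\<^sup>2 + \<bar>\<alpha> * (1 - \<alpha>)\<bar> * (gnorm w)\<^sup>2)"
proof (rule cancel_gnorm)
  have H: "g \<in> H" "g' \<in> H" "w \<in> H" "u \<in> H" "z \<in> H" using V w u by (auto simp: lincomb_def)
  \<comment> \<open>A quadratic form at an affine combination is the combination of its values minus
    \<alpha> (1 - \<alpha>) times its value at the difference.\<close>
  have quad: "b u u z = (1 - \<alpha>) * b g g z + \<alpha> * b g' g' z - \<alpha> * (1 - \<alpha>) * b w w z"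
  proof -
    have e: "b u u z = (1 - \<alpha>) * b g u z + \<alpha> * b g' u z"
      "b g u z = (1 - \<alpha>) * b g g z + \<alpha> * b g g' z" "b g' u z = (1 - \<alpha>) * b g' g z + \<alpha> * b g' g' z"
      "b w w z = b g w z - b g' w z"
      "b g w z = b g g z - b g g' z" "b g' w z = b g' g z - b g' g' z"
      using b_lincomb2[OF w H(1,5)] b_lincomb2[OF w H(2,5)] b_lincomb1[OF w H(3,5)]
        b_lincomb2[OF u H(1,5)] b_lincomb2[OF u H(2,5)] b_lincomb1[OF u H(4,5)] by simp_all
    show ?thesis unfolding e by (simp add: algebra_simps)
  qed
  have "(\<nu> - M * R) * (gnorm z)\<^sup>2 \<le> f z - b u u z - \<nu> * ginner u z"
    using coercivity[OF H(4,5) R(1), of \<nu>] newton_step_residual(1)[OF n V z] by (simp add: b_same)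
  \<comment> \<open>The weights sum to 1, so the forcing and viscous terms cancel against the
    equations of g and g', and only quadratic remainders survive.\<close>
  also have "\<dots> = - ((1 - \<alpha>) * b y y z) - \<alpha> * b y' y' z + \<alpha> * (1 - \<alpha>) * b w w z"
  proof -
    have i: "ginner u z = (1 - \<alpha>) * ginner g z + \<alpha> * ginner g' z"
      by (rule ginner_lincomb_left[OF u H(5)])
    have y: "b y y z = b g g z + \<nu> * ginner g z - f z" "b y' y' z = b g' g' z + \<nu> * ginner g' z - f z"
      using g[OF V(3)] g'[OF V(3)] by auto
    show ?thesis unfolding quad i y by (simp add: algebra_simps)
  qed
  also have "\<dots> \<le> \<bar>1 - \<alpha>\<bar> * \<bar>b y y z\<bar> + \<bar>\<alpha>\<bar> * \<bar>b y' y' z\<bar> + \<bar>\<alpha> * (1 - \<alpha>)\<bar> * \<bar>b w w z\<bar>"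
    unfolding abs_mult[symmetric] by linarith
  also have "\<dots> \<le> \<bar>1 - \<alpha>\<bar> * (M * (gnorm y)\<^sup>2 * gnorm z) + \<bar>\<alpha>\<bar> * (M * (gnorm y')\<^sup>2 * gnorm z) +
      \<bar>\<alpha> * (1 - \<alpha>)\<bar> * (M * (gnorm w)\<^sup>2 * gnorm z)"
    by (intro add_mono mult_left_mono abs_b_diag_le y H) auto
  finally show "(\<nu> - M * R) * (gnorm z)\<^sup>2 \<le> M * (\<bar>1 - \<alpha>\<bar> * (gnorm y)\<^sup>2 + \<bar>\<alpha>\<bar> * (gnorm y')\<^sup>2 +
      \<bar>\<alpha> * (1 - \<alpha>)\<bar> * (gnorm w)\<^sup>2) * gnorm z"
    by (simp add: algebra_simps)
qed (use R in auto)

section \<open>The estimate for one accelerated step\<close>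

lemma anderson_newton_residual_bound:
  assumes set: "nse_setting \<Omega> Xh Qh \<nu> M f" and V: "Vh = discretely_div_free \<Omega> Xh Qh"
    and R: "R < \<nu> * inverse M" and it: "anderson_newton \<Omega> Vh \<nu> f R N u ut y \<alpha>"
    and k: "2 \<le> k" "k + 1 \<le> N" and \<alpha>: "\<alpha> k \<noteq> 0"
    and ball: "\<forall>j\<le>k. u j \<in> grad_ball \<Omega> Vh R"
  shows "l2_norm \<Omega> (grad \<Omega> (y (k + 1)))
    \<le> residual_constant \<nu> M R (dual_norm \<Omega> f) (\<alpha> k) * l2_norm \<Omega> (grad \<Omega> (y k)) powr (3/2)"
proof -
  have \<nu>: "\<nu> > 0" and f: "forcing \<Omega> f"
    using set by (auto simp: nse_setting_def)
  have MR: "M * R < \<nu>"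
    using R M_pos by (simp add: field_simps)
  have VH: "Vh \<subseteq> H"
    using set unfolding V nse_setting_def finite_dim_subspace_def discretely_div_free_def by auto
  have uV: "u j \<in> Vh" "gnorm (u j) \<le> R" if "j \<le> k" for j
    using ball that by (auto simp: grad_ball_def)
  have yV: "y j \<in> Vh" "ut j \<in> Vh" if "1 \<le> j" "j \<le> N" for j
    using it that by (auto simp: anderson_newton_def)
  \<comment> \<open>Index \<open>k + 1\<close> is included: its Newton step starts from
    \<open>u k\<close>, which still lies in the ball by assumption.\<close>
  have step: "is_newton_step \<Omega> Vh \<nu> f (u (j - 1)) (ut j)"
    and ut: "lincomb (ut j) 1 (u (j - 1)) 1 (y j)" if "1 \<le> j" "j \<le> k + 1" for j
  proof -
    have j: "j \<in> {1..N}" using that k by auto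
    then show "is_newton_step \<Omega> Vh \<nu> f (u (j - 1)) (ut j)"
      using it by (auto simp: anderson_newton_def)
    have "ae_eq \<Omega> (y j) (\<lambda>x. ut j x - u (j - 1) x)"
      using it j by (auto simp: anderson_newton_def)
    then have "ae_eq \<Omega> (ut j) (\<lambda>x. 1 *\<^sub>R u (j - 1) x + 1 *\<^sub>R y j x)"
      unfolding ae_eq_def by eventually_elim simp
    then show "lincomb (ut j) 1 (u (j - 1)) 1 (y j)"
      using VH uV[of "j - 1"] yV[of j] j that by (auto simp: lincomb_def)
  qed
  have kN: "k \<in> {2..N}" using k by auto
  have idx: "1 \<le> k - 1" "k - 1 \<le> k + 1" "k - 1 \<le> N" "1 \<le> k" "k \<le> k + 1" "k \<le> N" "1 \<le> k + 1"
    using k by auto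
  have inV: "y (k - 1) \<in> Vh" "ut (k - 1) \<in> Vh" "y k \<in> Vh" "ut k \<in> Vh" "y (k + 1) \<in> Vh" "ut (k + 1) \<in> Vh"
    using yV idx k by auto
  have inH: "y (k - 1) \<in> H" "ut (k - 1) \<in> H" "y k \<in> H" "ut k \<in> H" "u k \<in> H"
    using inV uV(1)[of k] VH by auto
  define w where "w = (\<lambda>x. 1 *\<^sub>R ut k x + (-1) *\<^sub>R ut (k - 1) x)"
  have w: "lincomb w 1 (ut k) (-1) (ut (k - 1))"
    unfolding w_def using inH by (intro lincombI)
  have uk: "lincomb (u k) (1 - \<alpha> k) (ut k) (\<alpha> k) (ut (k - 1))"
    using it kN inH by (auto simp: lincomb_def anderson_newton_def)
  have res: "b (ut j) (ut j) v + \<nu> * ginner (ut j) v = f v + b (y j) (y j) v"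
    if "1 \<le> j" "j \<le> k" "v \<in> Vh" for j v
    using newton_step_residual(2)[OF step VH _ _ ut] that uV(1)[of "j - 1"] by auto
  \<comment> \<open>As \<open>\<alpha> k \<noteq> 0\<close>, the older residual can be recovered from \<open>y k\<close> and the minimizer.\<close>
  have small: "gnorm (y (k - 1)) \<le> (1 + \<bar>1 - \<alpha> k\<bar>) / \<bar>\<alpha> k\<bar> * gnorm (y k)"
  proof -
    define q where "q a = (\<lambda>x. (1 - a) *\<^sub>R y k x + a *\<^sub>R y (k - 1) x)" for a
    have q: "lincomb (q a) (1 - a) (y k) a (y (k - 1))" for a
      unfolding q_def using inH by (intro lincombI)
    have "is_arg_min (\<lambda>a. gnorm (q a)) (\<lambda>_. True) (\<alpha> k)"
      using it kN by (auto simp: anderson_newton_def q_def)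
    \<comment> \<open>The competitor a = 0 is the unaccelerated residual \<open>y k\<close>.\<close>
    then have "gnorm (q (\<alpha> k)) \<le> gnorm (q 0)"
      by (auto simp: is_arg_min_def not_less)
    also have "\<dots> \<le> gnorm (y k)"
      using gnorm_lincomb[OF q[of 0]] by simp
    finally have min: "gnorm (q (\<alpha> k)) \<le> gnorm (y k)" .
    have "ae_eq \<Omega> (y (k - 1)) (\<lambda>x. inverse (\<alpha> k) *\<^sub>R q (\<alpha> k) x + (- (1 - \<alpha> k) / \<alpha> k) *\<^sub>R y k x)"
    proof -
      have c: "- (1 - \<alpha> k) / \<alpha> k = - (inverse (\<alpha> k) * (1 - \<alpha> k))"
        by (simp add: divide_inverse algebra_simps)
      show ?thesis
        unfolding c scaleR_minus_left using \<alpha> by (simp add: ae_eq_def q_def scaleR_right_distrib)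
    qed
    then have "lincomb (y (k - 1)) (inverse (\<alpha> k)) (q (\<alpha> k)) (- (1 - \<alpha> k) / \<alpha> k) (y k)"
      using q[of "\<alpha> k"] by (auto simp: lincomb_def)
    from gnorm_lincomb[OF this]
    have "gnorm (y (k - 1)) \<le> inverse \<bar>\<alpha> k\<bar> * gnorm (q (\<alpha> k)) + \<bar>1 - \<alpha> k\<bar> / \<bar>\<alpha> k\<bar> * gnorm (y k)"
      by (simp only: abs_inverse abs_divide abs_minus_cancel)
    also have "\<dots> \<le> inverse \<bar>\<alpha> k\<bar> * gnorm (y k) + \<bar>1 - \<alpha> k\<bar> / \<bar>\<alpha> k\<bar> * gnorm (y k)"
      using min by (intro add_right_mono mult_left_mono) auto
    also have "\<dots> = (1 + \<bar>1 - \<alpha> k\<bar>) / \<bar>\<alpha> k\<bar> * gnorm (y k)"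
      by (simp add: divide_inverse algebra_simps)
    finally show ?thesis .
  qed
  show ?thesis
  proof (rule residual_scalar_bound[where p = "gnorm (y (k - 1))" and w = "gnorm w"])
    show "gnorm (y k) \<le> (dual_norm \<Omega> f + M * R\<^sup>2 + \<nu> * R) / (\<nu> - M * R)" if "gnorm (y k) \<noteq> 0"
      using newton_residual_bound[OF step[of k] VH uV(1) inV(3) ut[of k] uV(2) MR f \<nu> that] idx
      by auto
    show "gnorm w \<le> M / (\<nu> - M * R) * ((gnorm (y k))\<^sup>2 + (gnorm (y (k - 1)))\<^sup>2)"
      using res idx uV(2)[of k]
      by (intro newton_difference_bound[OF VH inV(4,2) inH(3,1) _ _ w uk _ MR]) auto
    show "gnorm (y (k + 1)) \<le> M / (\<nu> - M * R) * (\<bar>1 - \<alpha> k\<bar> * (gnorm (y k))\<^sup>2 +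
        \<bar>\<alpha> k\<bar> * (gnorm (y (k - 1)))\<^sup>2 + \<bar>\<alpha> k * (1 - \<alpha> k)\<bar> * (gnorm w)\<^sup>2)"
      using res idx uV[of k] step[of "k + 1"] ut[of "k + 1"]
      by (intro accelerated_residual_bound[OF VH _ inV(5) inH(3,1) _ _ w uk _ _ _ MR]) auto
    show "0 \<le> M / (\<nu> - M * R)" using M_pos MR by simp
  qed (use small in \<open>auto simp: l2_norm_nonneg\<close>)
qed

end

lemma nse_setting_trilinear_form:
  "nse_setting \<Omega> Xh Qh \<nu> M f \<Longrightarrow> continuous_trilinear_form \<Omega> M"
  by unfold_locales (auto simp: nse_setting_def flow_domain_def)

text \<open>Stated for every dimension, so that the two conjuncts of the theorem are instances with
  one and the same constant.\<close>

lemma anderson_newton_estimate: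
  fixes \<Omega> :: "(real^'d) set"
  assumes "nse_setting \<Omega> Xh Qh \<nu> M f" "Vh = discretely_div_free \<Omega> Xh Qh" "R < \<nu> * inverse M"
    "anderson_newton \<Omega> Vh \<nu> f R N u ut y \<alpha>" "2 \<le> k" "k + 1 \<le> N" "\<alpha> k \<noteq> 0"
    "\<forall>j\<le>k. u j \<in> grad_ball \<Omega> Vh R"
  shows "l2_norm \<Omega> (grad \<Omega> (y (k + 1)))
    \<le> residual_constant \<nu> M R (dual_norm \<Omega> f) (\<alpha> k) * l2_norm \<Omega> (grad \<Omega> (y k)) powr (3/2)"
proof -
  interpret continuous_trilinear_form \<Omega> M
    using assms(1) by (rule nse_setting_trilinear_form)
  show ?thesis using assms by (rule anderson_newton_residual_bound)
qed

theorem theorem3p6: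
  shows "\<exists>C\<^sub>2 :: real \<Rightarrow> real \<Rightarrow> real \<Rightarrow> real \<Rightarrow> real \<Rightarrow> real \<Rightarrow> real.
       (\<forall>(\<Omega>::(real^2) set) Xh Qh Vh \<nu> M R f N u ut y \<alpha> k.
          nse_setting \<Omega> Xh Qh \<nu> M f \<longrightarrow>
          Vh = discretely_div_free \<Omega> Xh Qh \<longrightarrow>
          R < \<nu> * inverse M \<longrightarrow>
          anderson_newton \<Omega> Vh \<nu> f R N u ut y \<alpha> \<longrightarrow>
          2 \<le> k \<longrightarrow> k + 1 \<le> N \<longrightarrow>
          \<alpha> k \<noteq> 0 \<longrightarrow>
          (\<forall>j\<le>k. u j \<in> grad_ball \<Omega> Vh R) \<longrightarrow>
          l2_norm \<Omega> (grad \<Omega> (y (k + 1)))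
            \<le> C\<^sub>2 \<nu> M R (dual_norm \<Omega> f) (\<alpha> k) (opt_gain \<Omega> y \<alpha> k)
               * l2_norm \<Omega> (grad \<Omega> (y k)) powr (3/2)) \<and>
       (\<forall>(\<Omega>::(real^3) set) Xh Qh Vh \<nu> M R f N u ut y \<alpha> k.
          nse_setting \<Omega> Xh Qh \<nu> M f \<longrightarrow>
          Vh = discretely_div_free \<Omega> Xh Qh \<longrightarrow>
          R < \<nu> * inverse M \<longrightarrow>
          anderson_newton \<Omega> Vh \<nu> f R N u ut y \<alpha> \<longrightarrow>
          2 \<le> k \<longrightarrow> k + 1 \<le> N \<longrightarrow>
          \<alpha> k \<noteq> 0 \<longrightarrow>
          (\<forall>j\<le>k. u j \<in> grad_ball \<Omega> Vh R) \<longrightarrow>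
          l2_norm \<Omega> (grad \<Omega> (y (k + 1)))
            \<le> C\<^sub>2 \<nu> M R (dual_norm \<Omega> f) (\<alpha> k) (opt_gain \<Omega> y \<alpha> k)
               * l2_norm \<Omega> (grad \<Omega> (y k)) powr (3/2))"
  by (rule exI[of _ "\<lambda>\<nu> M R F \<alpha> _. residual_constant \<nu> M R F \<alpha>"])
     (intro conjI allI impI; rule anderson_newton_estimate; assumption)

end
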